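(* Let $(M,g,S(TM))$ be a null screen isoparametric hypersurface of a Lorentzian manifold $(\bar M^{n+2}_{\bar c},\bar g)$ of constant curvature $\bar c$ such that $\tau(X)=0$ for all $X\in\Gamma(S(TM))$. Let $X\in S(TM)_p$ be a unit eigenvector of $A^*_\xi$ at a point $p\in M$ and let $\lambda$ be the associated screen principal curvature. Then for any frame field $\{\xi,E_1,\dots,E_n\}$ of eigenvectors of $A^*_\xi$ such that $\{E_1,\dots,E_n\}$ is an orthonormal frame field of $S(TM)$ with $A^*_\xi E_j=\lambda_jE_j$, one has \[ \sum_{\lambda_j\neq\lambda}\frac{\bar c+\lambda\, g(A_NE_j,E_j)+\lambda_j\, g(A_NX,X)}{\lambda-\lambda_j}=0, \] the sum being over all indices $j\in\{1,\dots,n\}$ with $\lambda_j\ne\lambda$. Moreover, if $(M,g,S(TM))$ is screen quasi-conformal near $p$ with quasi-conformal pair $(\varphi,\psi)$, $\psi\not\equiv0$, and has $l>1$ distinct screen principal curvatures $\lambda_1,\dots,\lambda_l$ with multiplicities $m_1,\dots,m_l$, then for each $i$, $1\le i\le l$, \[ \sum_{j\neq i}m_j\,\frac{\bar c+2\varphi\lambda_i\lambda_j+\psi(\lambda_i+\lambda_j)}{\lambda_i-\lambda_j}=0 . \]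
   Context: Setting: $(\bar M^{n+2},\bar g)$ is a Lorentzian manifold with Levi-Civita connection $\bar\nabla$. A hypersurface $M\subset\bar M$ with induced (degenerate) metric $g$ is null if $\mathrm{Rad}(TM)=TM\cap TM^\perp$ is nonzero at each point (then it has rank $1$ and equals $TM^\perp$). A screen distribution $S(TM)$ is a non-degenerate (here necessarily spacelike) subbundle of $TM$ complementary to $TM^\perp$; $P:\Gamma(TM)\to\Gamma(S(TM))$ is the projection for $TM=S(TM)\oplus_{\mathrm{orth}}\mathrm{Rad}(TM)$. For a nowhere zero local section $\xi$ of $TM^\perp$ there is a unique vector field $N$ along $M$ with $\bar g(\xi,N)=1$, $\bar g(N,N)=0$, $\bar g(N,X)=0$ for all $X\in\Gamma(S(TM))$. One works on a domain where such $\xi,N$ are fixed. Gauss-Weingarten formulas, for $X,Y\in\Gamma(TM)$: $\bar\nabla_XY=\nabla_XY+B(X,Y)N$, $\ \bar\nabla_XN=-A_NX+\tau(X)N$, $\ \nabla_XPY=\nabla^*_XPY+C(X,PY)\xi$, $\ \nabla_X\xi=-A^*_\xi X-\tau(X)\xi$, where $\nabla_XY\in\Gamma(TM)$, $\nabla^*_XPY,\ A_NX,\ A^*_\xi X\in\Gamma(S(TM))$ and $\tau(X)=\bar g(\bar\nabla_XN,\xi)$. Thus $B(X,Y)=g(A^*_\xi X,Y)$ and $C(X,PY)=g(A_NX,PY)$. Since $A^*_\xi$ is $g$-symmetric with $A^*_\xi\xi=0$, there is a frame $\{\xi,E_1,\dots,E_n\}$ of eigenvectors of $A^*_\xi$ with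 $\{E_1,\dots,E_n\}$ an orthonormal frame of $S(TM)$; the numbers $\lambda_i$ with $A^*_\xi E_i=\lambda_iE_i$, $i=1,\dots,n$, are the screen principal curvatures. $(M,g,S(TM))$ is null screen isoparametric if all screen principal curvatures are constant along $S(TM)$, i.e. have zero derivative in the directions of $S(TM)$. $(M,g,S(TM))$ is screen quasi-conformal (on a domain) with quasi-conformal pair $(\varphi,\psi)$ if $A_N=\varphi A^*_\xi+\psi P$ there, for (smooth) functions $\varphi,\psi$. *)

theory Defs
  imports "HOL-Analysis.Analysis" "HOL-Library.Function_Algebras"
begin

section \<open>Smooth manifolds\<close>

instantiation "fun" :: (type, real_vector) real_vector
begin

definition "scaleR_fun a f = (\<lambda>x. a *\<^sub>R f x)"

instance
  by standard (simp_all add: scaleR_fun_def fun_eq_iff scaleR_add_right scaleR_add_left)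

end

text \<open>
  \<open>Ck_on k U f\<close>: \<open>f\<close> is of class \<open>C\<^sup>k\<close> on the open set \<open>U\<close>. As the domain is finite
  dimensional, it suffices to control the directional derivatives \<open>x \<mapsto> f' x v\<close>.
\<close>

primrec Ck_on ::
    "nat \<Rightarrow> 'a::euclidean_space set \<Rightarrow> ('a \<Rightarrow> 'b::real_normed_vector) \<Rightarrow> bool" where
  "Ck_on 0 U f \<longleftrightarrow> continuous_on U f"
| "Ck_on (Suc k) U f \<longleftrightarrow>
     (\<exists>f'. (\<forall>x\<in>U. (f has_derivative f' x) (at x)) \<and> (\<forall>v. Ck_on k U (\<lambda>x. f' x v)))"

definition smooth_on ::
    "'a::euclidean_space set \<Rightarrow> ('a \<Rightarrow> 'b::real_normed_vector) \<Rightarrow> bool" where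
  "smooth_on U f \<longleftrightarrow> (\<forall>k. Ck_on k U f)"

text \<open>
  The manifold is the whole type \<open>'m\<close> with its topology (Hausdorff and second countable by
  the sort constraints in the theorem). A chart is a pair of a domain and a coordinate map into
  the Euclidean space \<open>'a\<close>, so that the dimension of the manifold is \<open>DIM('a)\<close>.
\<close>

type_synonym ('m, 'a) atlas = "('m set \<times> ('m \<Rightarrow> 'a)) set"

definition smooth_atlas ::
    "('m::topological_space, 'a::euclidean_space) atlas \<Rightarrow> bool" where
  "smooth_atlas A \<longleftrightarrow>
     (\<Union>(U, \<phi>)\<in>A. U) = UNIV \<and>
     (\<forall>(U, \<phi>)\<in>A. open U \<and> open (\<phi> ` U) \<and> homeomorphism U (\<phi> ` U) \<phi> (inv_into U \<phi>)) \<and>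
     (\<forall>(U, \<phi>)\<in>A. \<forall>(V, \<psi>)\<in>A. smooth_on (\<phi> ` (U \<inter> V)) (\<psi> \<circ> inv_into U \<phi>))"

definition smooth_functions ::
    "('m::topological_space, 'a::euclidean_space) atlas \<Rightarrow> ('m \<Rightarrow> real) set" where
  "smooth_functions A = {f. \<forall>(U, \<phi>)\<in>A. smooth_on (\<phi> ` U) (f \<circ> inv_into U \<phi>)}"

text \<open>
  Tangent vectors at \<open>p\<close> are the derivations at \<open>p\<close> of the algebra of smooth functions. They
  are set to \<open>0\<close> on functions that are not smooth, so that equality of tangent vectors is
  equality in HOL. Vector fields are sections; bundle data over a point take that point as an
  argument.
\<close>

type_synonym 'm tvec = "('m \<Rightarrow> real) \<Rightarrow> real"
type_synonym 'm vfield = "'m \<Rightarrow> 'm tvec"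

definition tangent_space ::
    "('m::topological_space, 'a::euclidean_space) atlas \<Rightarrow> 'm \<Rightarrow> 'm tvec set" where
  "tangent_space A p = {v.
     (\<forall>f\<in>smooth_functions A. \<forall>h\<in>smooth_functions A. \<forall>a b::real.
        v (\<lambda>q. a * f q + b * h q) = a * v f + b * v h) \<and>
     (\<forall>f\<in>smooth_functions A. \<forall>h\<in>smooth_functions A.
        v (\<lambda>q. f q * h q) = f p * v h + h p * v f) \<and>
     (\<forall>f. f \<notin> smooth_functions A \<longrightarrow> v f = 0)}"

definition vector_fields ::
    "('m::topological_space, 'a::euclidean_space) atlas \<Rightarrow> 'm vfield set" where
  "vector_fields A = {X. (\<forall>p. X p \<in> tangent_space A p) \<and>
     (\<forall>f\<in>smooth_functions A. (\<lambda>p. X p f) \<in> smooth_functions A)}"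

definition lie_bracket :: "'m vfield \<Rightarrow> 'm vfield \<Rightarrow> 'm vfield" where
  "lie_bracket X Y p f = X p (\<lambda>q. Y q f) - Y p (\<lambda>q. X q f)"


section \<open>Lorentzian geometry\<close>

type_synonym 'm metric = "'m \<Rightarrow> 'm tvec \<Rightarrow> 'm tvec \<Rightarrow> real"

text \<open>Signature \<open>(-,+,\<dots>,+)\<close>.\<close>

definition lorentzian_metric ::
    "('m::topological_space, 'a::euclidean_space) atlas \<Rightarrow> 'm metric \<Rightarrow> bool" where
  "lorentzian_metric A g \<longleftrightarrow>
     (\<forall>p. \<forall>u\<in>tangent_space A p. \<forall>v\<in>tangent_space A p. \<forall>w\<in>tangent_space A p. \<forall>a b.
        g p u v = g p v u \<and> g p (a *\<^sub>R u + b *\<^sub>R v) w = a * g p u w + b * g p v w) \<and>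
     (\<forall>X\<in>vector_fields A. \<forall>Y\<in>vector_fields A.
        (\<lambda>p. g p (X p) (Y p)) \<in> smooth_functions A) \<and>
     (\<forall>p. \<exists>e::nat \<Rightarrow> 'm tvec.
        span (e ` {..<DIM('a)}) = tangent_space A p \<and>
        (\<forall>i<DIM('a). \<forall>j<DIM('a).
           g p (e i) (e j) = (if i \<noteq> j then 0 else if i = 0 then - 1 else 1)))"

text \<open>
  A connection is given as \<open>D p v Y\<close>, the derivative at \<open>p\<close> of the vector field \<open>Y\<close> in the
  direction of the tangent vector \<open>v\<close> at \<open>p\<close>.
\<close>

type_synonym 'm connection = "'m \<Rightarrow> 'm tvec \<Rightarrow> 'm vfield \<Rightarrow> 'm tvec"

definition affine_connection ::
    "('m::topological_space, 'a::euclidean_space) atlas \<Rightarrow> 'm connection \<Rightarrow> bool" where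
  "affine_connection A D \<longleftrightarrow>
     (\<forall>p. \<forall>v\<in>tangent_space A p. \<forall>Y\<in>vector_fields A. D p v Y \<in> tangent_space A p) \<and>
     (\<forall>X\<in>vector_fields A. \<forall>Y\<in>vector_fields A. (\<lambda>p. D p (X p) Y) \<in> vector_fields A) \<and>
     (\<forall>p. \<forall>u\<in>tangent_space A p. \<forall>v\<in>tangent_space A p. \<forall>Y\<in>vector_fields A. \<forall>a b.
        D p (a *\<^sub>R u + b *\<^sub>R v) Y = a *\<^sub>R D p u Y + b *\<^sub>R D p v Y) \<and>
     (\<forall>p. \<forall>v\<in>tangent_space A p. \<forall>Y\<in>vector_fields A. \<forall>Z\<in>vector_fields A.
        D p v (\<lambda>q. Y q + Z q) = D p v Y + D p v Z) \<and>
     (\<forall>p. \<forall>v\<in>tangent_space A p. \<forall>f\<in>smooth_functions A. \<forall>Y\<in>vector_fields A.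
        D p v (\<lambda>q. f q *\<^sub>R Y q) = v f *\<^sub>R Y p + f p *\<^sub>R D p v Y)"

definition levi_civita ::
    "('m::topological_space, 'a::euclidean_space) atlas \<Rightarrow> 'm metric \<Rightarrow> 'm connection \<Rightarrow> bool" where
  "levi_civita A g D \<longleftrightarrow>
     affine_connection A D \<and>
     (\<forall>X\<in>vector_fields A. \<forall>Y\<in>vector_fields A. \<forall>p.
        D p (X p) Y - D p (Y p) X = lie_bracket X Y p) \<and>
     (\<forall>p. \<forall>v\<in>tangent_space A p. \<forall>Y\<in>vector_fields A. \<forall>Z\<in>vector_fields A.
        v (\<lambda>q. g q (Y q) (Z q)) = g p (D p v Y) (Z p) + g p (Y p) (D p v Z))"

definition curvature ::
    "'m connection \<Rightarrow> 'm vfield \<Rightarrow> 'm vfield \<Rightarrow> 'm vfield \<Rightarrow> 'm vfield" where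
  "curvature D X Y Z p =
     D p (X p) (\<lambda>q. D q (Y q) Z) - D p (Y p) (\<lambda>q. D q (X q) Z) - D p (lie_bracket X Y p) Z"

definition gram2 :: "'m metric \<Rightarrow> 'm vfield \<Rightarrow> 'm vfield \<Rightarrow> 'm \<Rightarrow> real" where
  "gram2 g X Y p = g p (X p) (X p) * g p (Y p) (Y p) - (g p (X p) (Y p))\<^sup>2"

definition sectional_curvature ::
    "'m metric \<Rightarrow> 'm connection \<Rightarrow> 'm vfield \<Rightarrow> 'm vfield \<Rightarrow> 'm \<Rightarrow> real" where
  "sectional_curvature g D X Y p = g p (curvature D X Y Y p) (X p) / gram2 g X Y p"

text \<open>
  The sectional curvature is defined on the non-degenerate tangent planes, which are those
  spanned by \<open>X p\<close>, \<open>Y p\<close> with \<open>gram2 g X Y p \<noteq> 0\<close>.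
\<close>

definition constant_curvature ::
    "('m::topological_space, 'a::euclidean_space) atlas \<Rightarrow> 'm metric \<Rightarrow> 'm connection \<Rightarrow>
       real \<Rightarrow> bool" where
  "constant_curvature A g D c \<longleftrightarrow>
     (\<forall>X\<in>vector_fields A. \<forall>Y\<in>vector_fields A. \<forall>p.
        gram2 g X Y p \<noteq> 0 \<longrightarrow> sectional_curvature g D X Y p = c)"


section \<open>Hypersurfaces\<close>

text \<open>
  An embedded hypersurface is locally the zero set of a function with non-vanishing
  differential. (By means of bump functions, local defining functions can be taken to be
  globally smooth.)
\<close>

definition hypersurface ::
    "('m::topological_space, 'a::euclidean_space) atlas \<Rightarrow> 'm set \<Rightarrow> bool" where
  "hypersurface A M \<longleftrightarrow>
     (\<forall>p\<in>M. \<exists>U f. open U \<and> p \<in> U \<and> f \<in> smooth_functions A \<and>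
        M \<inter> U = {q\<in>U. f q = 0} \<and> (\<forall>q\<in>M \<inter> U. \<exists>v\<in>tangent_space A q. v f \<noteq> 0))"

definition agree_near ::
    "'m::topological_space set \<Rightarrow> 'm \<Rightarrow> ('m \<Rightarrow> 'b) \<Rightarrow> ('m \<Rightarrow> 'b) \<Rightarrow> bool" where
  "agree_near M p F G \<longleftrightarrow> (\<exists>U. open U \<and> p \<in> U \<and> (\<forall>q\<in>M \<inter> U. F q = G q))"

text \<open>\<open>T\<^sub>pM\<close> as a subspace of the tangent space of the ambient manifold.\<close>

definition tangent_sub ::
    "('m::topological_space, 'a::euclidean_space) atlas \<Rightarrow> 'm set \<Rightarrow> 'm \<Rightarrow> 'm tvec set" where
  "tangent_sub A M p =
     {v\<in>tangent_space A p. \<forall>f\<in>smooth_functions A. agree_near M p f (\<lambda>q. 0) \<longrightarrow> v f = 0}"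

text \<open>
  Smooth functions on an open subset \<open>W\<close> of \<open>M\<close>, and smooth sections over \<open>W\<close> of the ambient
  tangent bundle: those which locally extend smoothly to the ambient manifold.
\<close>

definition smooth_function_along ::
    "('m::topological_space, 'a::euclidean_space) atlas \<Rightarrow> 'm set \<Rightarrow> 'm set \<Rightarrow>
       ('m \<Rightarrow> real) \<Rightarrow> bool" where
  "smooth_function_along A M W f \<longleftrightarrow> (\<forall>p\<in>W. \<exists>h\<in>smooth_functions A. agree_near M p h f)"

definition smooth_field_along ::
    "('m::topological_space, 'a::euclidean_space) atlas \<Rightarrow> 'm set \<Rightarrow> 'm set \<Rightarrow>
       'm vfield \<Rightarrow> bool" where
  "smooth_field_along A M W X \<longleftrightarrow> (\<forall>p\<in>W. \<exists>Y\<in>vector_fields A. agree_near M p Y X)"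

text \<open>
  Derivatives in the direction of \<open>v \<in> T\<^sub>pM\<close> of smooth functions on \<open>M\<close> and of smooth vector
  fields along \<open>M\<close> are computed with any local extension.
\<close>

definition deriv_along ::
    "('m::topological_space, 'a::euclidean_space) atlas \<Rightarrow> 'm set \<Rightarrow> 'm \<Rightarrow> 'm tvec \<Rightarrow>
       ('m \<Rightarrow> real) \<Rightarrow> real" where
  "deriv_along A M p v f = (THE d. \<exists>h\<in>smooth_functions A. agree_near M p h f \<and> d = v h)"

definition cov_along ::
    "('m::topological_space, 'a::euclidean_space) atlas \<Rightarrow> 'm connection \<Rightarrow> 'm set \<Rightarrow> 'm \<Rightarrow>
       'm tvec \<Rightarrow> 'm vfield \<Rightarrow> 'm tvec" where
  "cov_along A D M p v X = (THE w. \<exists>Y\<in>vector_fields A. agree_near M p Y X \<and> w = D p v Y)"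


section \<open>Null hypersurfaces\<close>

definition tangent_perp ::
    "('m::topological_space, 'a::euclidean_space) atlas \<Rightarrow> 'm metric \<Rightarrow> 'm set \<Rightarrow> 'm \<Rightarrow>
       'm tvec set" where
  "tangent_perp A g M p = {v\<in>tangent_space A p. \<forall>w\<in>tangent_sub A M p. g p v w = 0}"

definition radical ::
    "('m::topological_space, 'a::euclidean_space) atlas \<Rightarrow> 'm metric \<Rightarrow> 'm set \<Rightarrow> 'm \<Rightarrow>
       'm tvec set" where
  "radical A g M p = tangent_sub A M p \<inter> tangent_perp A g M p"

definition null_hypersurface ::
    "('m::topological_space, 'a::euclidean_space) atlas \<Rightarrow> 'm metric \<Rightarrow> 'm set \<Rightarrow> bool" where
  "null_hypersurface A g M \<longleftrightarrow> hypersurface A M \<and> (\<forall>p\<in>M. radical A g M p \<noteq> {0})"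

text \<open>
  Since \<open>TM\<close> has rank \<open>DIM('a) - 1\<close> and \<open>TM\<^sup>\<bottom>\<close> has rank 1, the screen distribution has
  rank \<open>DIM('a) - 2\<close>.
\<close>

definition screen_distribution ::
    "('m::topological_space, 'a::euclidean_space) atlas \<Rightarrow> 'm metric \<Rightarrow> 'm set \<Rightarrow>
       ('m \<Rightarrow> 'm tvec set) \<Rightarrow> bool" where
  "screen_distribution A g M S \<longleftrightarrow>
     (\<forall>p\<in>M. \<exists>W X. openin (top_of_set M) W \<and> p \<in> W \<and>
        (\<forall>j\<in>{1..DIM('a) - 2}. smooth_field_along A M W (X j)) \<and>
        (\<forall>q\<in>W. inj_on (\<lambda>j::nat. X j q) {1..DIM('a) - 2} \<and>
                independent ((\<lambda>j. X j q) ` {1..DIM('a) - 2}) \<and>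
                span ((\<lambda>j. X j q) ` {1..DIM('a) - 2}) = S q)) \<and>
     (\<forall>p\<in>M. S p \<inter> tangent_perp A g M p = {0} \<and>
        {s + r | s r. s \<in> S p \<and> r \<in> tangent_perp A g M p} = tangent_sub A M p \<and>
        (\<forall>v\<in>S p. (\<forall>w\<in>S p. g p v w = 0) \<longrightarrow> v = 0))"

definition screen_proj ::
    "('m::topological_space, 'a::euclidean_space) atlas \<Rightarrow> 'm metric \<Rightarrow> 'm set \<Rightarrow>
       ('m \<Rightarrow> 'm tvec set) \<Rightarrow> 'm \<Rightarrow> 'm tvec \<Rightarrow> 'm tvec" where
  "screen_proj A g M S p v = (THE s. s \<in> S p \<and> v - s \<in> radical A g M p)"

definition null_section ::
    "('m::topological_space, 'a::euclidean_space) atlas \<Rightarrow> 'm metric \<Rightarrow> 'm set \<Rightarrow>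
       'm vfield \<Rightarrow> bool" where
  "null_section A g M \<xi> \<longleftrightarrow>
     smooth_field_along A M M \<xi> \<and> (\<forall>p\<in>M. \<xi> p \<in> tangent_perp A g M p \<and> \<xi> p \<noteq> 0)"

definition null_transversal ::
    "('m::topological_space, 'a::euclidean_space) atlas \<Rightarrow> 'm metric \<Rightarrow> 'm set \<Rightarrow>
       ('m \<Rightarrow> 'm tvec set) \<Rightarrow> 'm vfield \<Rightarrow> 'm vfield \<Rightarrow> bool" where
  "null_transversal A g M S \<xi> N \<longleftrightarrow>
     smooth_field_along A M M N \<and>
     (\<forall>p\<in>M. g p (\<xi> p) (N p) = 1 \<and> g p (N p) (N p) = 0 \<and> (\<forall>v\<in>S p. g p (N p) v = 0))"


section \<open>Gauss-Weingarten formulas\<close>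

text \<open>
  \<open>B(v, Y)\<close> is the coefficient of \<open>N\<close> in the derivative of \<open>Y\<close>; it is extracted by pairing
  with \<open>\<xi>\<close>, as \<open>\<xi>\<close> is orthogonal to \<open>TM\<close> and has product 1 with \<open>N\<close>.
\<close>

definition null_sff ::
    "('m::topological_space, 'a::euclidean_space) atlas \<Rightarrow> 'm metric \<Rightarrow> 'm connection \<Rightarrow>
       'm set \<Rightarrow> 'm vfield \<Rightarrow> 'm \<Rightarrow> 'm tvec \<Rightarrow> 'm vfield \<Rightarrow> real" where
  "null_sff A g D M \<xi> p v Y = g p (cov_along A D M p v Y) (\<xi> p)"

definition induced_connection ::
    "('m::topological_space, 'a::euclidean_space) atlas \<Rightarrow> 'm metric \<Rightarrow> 'm connection \<Rightarrow>
       'm set \<Rightarrow> 'm vfield \<Rightarrow> 'm vfield \<Rightarrow> 'm \<Rightarrow> 'm tvec \<Rightarrow> 'm vfield \<Rightarrow> 'm tvec" where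
  "induced_connection A g D M \<xi> N p v Y =
     cov_along A D M p v Y - null_sff A g D M \<xi> p v Y *\<^sub>R N p"

definition null_tau ::
    "('m::topological_space, 'a::euclidean_space) atlas \<Rightarrow> 'm metric \<Rightarrow> 'm connection \<Rightarrow>
       'm set \<Rightarrow> 'm vfield \<Rightarrow> 'm vfield \<Rightarrow> 'm \<Rightarrow> 'm tvec \<Rightarrow> real" where
  "null_tau A g D M \<xi> N p v = g p (cov_along A D M p v N) (\<xi> p)"

text \<open>The operators \<open>A\<^sub>N\<close> and \<open>A\<^sup>*\<^sub>\<xi>\<close>, solved for from the Weingarten formulas.\<close>

definition shape_N ::
    "('m::topological_space, 'a::euclidean_space) atlas \<Rightarrow> 'm metric \<Rightarrow> 'm connection \<Rightarrow>
       'm set \<Rightarrow> 'm vfield \<Rightarrow> 'm vfield \<Rightarrow> 'm \<Rightarrow> 'm tvec \<Rightarrow> 'm tvec" where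
  "shape_N A g D M \<xi> N p v =
     null_tau A g D M \<xi> N p v *\<^sub>R N p - cov_along A D M p v N"

definition shape_\<xi> ::
    "('m::topological_space, 'a::euclidean_space) atlas \<Rightarrow> 'm metric \<Rightarrow> 'm connection \<Rightarrow>
       'm set \<Rightarrow> 'm vfield \<Rightarrow> 'm vfield \<Rightarrow> 'm \<Rightarrow> 'm tvec \<Rightarrow> 'm tvec" where
  "shape_\<xi> A g D M \<xi> N p v =
     - induced_connection A g D M \<xi> N p v \<xi> - null_tau A g D M \<xi> N p v *\<^sub>R \<xi> p"


section \<open>Screen principal curvatures\<close>

definition screen_eigenspace ::
    "('m::topological_space, 'a::euclidean_space) atlas \<Rightarrow> 'm metric \<Rightarrow> 'm connection \<Rightarrow>
       'm set \<Rightarrow> ('m \<Rightarrow> 'm tvec set) \<Rightarrow> 'm vfield \<Rightarrow> 'm vfield \<Rightarrow> 'm \<Rightarrow> real \<Rightarrow>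
       'm tvec set" where
  "screen_eigenspace A g D M S \<xi> N p \<mu> = {v\<in>S p. shape_\<xi> A g D M \<xi> N p v = \<mu> *\<^sub>R v}"

definition screen_principal_curvatures ::
    "('m::topological_space, 'a::euclidean_space) atlas \<Rightarrow> 'm metric \<Rightarrow> 'm connection \<Rightarrow>
       'm set \<Rightarrow> ('m \<Rightarrow> 'm tvec set) \<Rightarrow> 'm vfield \<Rightarrow> 'm vfield \<Rightarrow> 'm \<Rightarrow> real set" where
  "screen_principal_curvatures A g D M S \<xi> N p =
     {\<mu>. \<exists>v\<in>screen_eigenspace A g D M S \<xi> N p \<mu>. v \<noteq> 0}"

text \<open>
  A smooth orthonormal frame \<open>E\<^sub>1, \<dots>, E\<^sub>n\<close> of \<open>S(TM)\<close> over the open subset \<open>W\<close> of \<open>M\<close>, with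
  \<open>A\<^sup>*\<^sub>\<xi> E\<^sub>j = \<kappa>\<^sub>j E\<^sub>j\<close>. Smoothness of \<open>\<kappa>\<^sub>j = g(A\<^sup>*\<^sub>\<xi> E\<^sub>j, E\<^sub>j)\<close> is automatic, and so is
  \<open>A\<^sup>*\<^sub>\<xi> \<xi> = 0\<close>.
\<close>

definition screen_eigenframe ::
    "('m::topological_space, 'a::euclidean_space) atlas \<Rightarrow> 'm metric \<Rightarrow> 'm connection \<Rightarrow>
       'm set \<Rightarrow> ('m \<Rightarrow> 'm tvec set) \<Rightarrow> 'm vfield \<Rightarrow> 'm vfield \<Rightarrow> 'm set \<Rightarrow>
       (nat \<Rightarrow> 'm vfield) \<Rightarrow> (nat \<Rightarrow> 'm \<Rightarrow> real) \<Rightarrow> bool" where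
  "screen_eigenframe A g D M S \<xi> N W E \<kappa> \<longleftrightarrow>
     openin (top_of_set M) W \<and>
     (\<forall>j\<in>{1..DIM('a) - 2}. smooth_field_along A M W (E j)) \<and>
     (\<forall>q\<in>W.
        span ((\<lambda>j. E j q) ` {1..DIM('a) - 2}) = S q \<and>
        (\<forall>i\<in>{1..DIM('a) - 2}. \<forall>j\<in>{1..DIM('a) - 2}.
           g q (E i q) (E j q) = (if i = j then 1 else 0)) \<and>
        (\<forall>j\<in>{1..DIM('a) - 2}. shape_\<xi> A g D M \<xi> N q (E j q) = \<kappa> j q *\<^sub>R E j q))"

text \<open>
  The screen principal curvature functions are the eigenvalue functions of local frames as
  above. Such frames are taken to exist around each point, and all the eigenvalue functions are
  required to be constant along \<open>S(TM)\<close>.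
\<close>

definition null_screen_isoparametric ::
    "('m::topological_space, 'a::euclidean_space) atlas \<Rightarrow> 'm metric \<Rightarrow> 'm connection \<Rightarrow>
       'm set \<Rightarrow> ('m \<Rightarrow> 'm tvec set) \<Rightarrow> 'm vfield \<Rightarrow> 'm vfield \<Rightarrow> bool" where
  "null_screen_isoparametric A g D M S \<xi> N \<longleftrightarrow>
     (\<forall>p\<in>M. \<exists>W E \<kappa>. p \<in> W \<and> screen_eigenframe A g D M S \<xi> N W E \<kappa>) \<and>
     (\<forall>W E \<kappa>. screen_eigenframe A g D M S \<xi> N W E \<kappa> \<longrightarrow>
        (\<forall>q\<in>W. \<forall>v\<in>S q. \<forall>j\<in>{1..DIM('a) - 2}. deriv_along A M q v (\<kappa> j) = 0))"

definition screen_quasi_conformal ::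
    "('m::topological_space, 'a::euclidean_space) atlas \<Rightarrow> 'm metric \<Rightarrow> 'm connection \<Rightarrow>
       'm set \<Rightarrow> ('m \<Rightarrow> 'm tvec set) \<Rightarrow> 'm vfield \<Rightarrow> 'm vfield \<Rightarrow> 'm set \<Rightarrow>
       ('m \<Rightarrow> real) \<Rightarrow> ('m \<Rightarrow> real) \<Rightarrow> bool" where
  "screen_quasi_conformal A g D M S \<xi> N W \<phi> \<psi> \<longleftrightarrow>
     openin (top_of_set M) W \<and>
     smooth_function_along A M W \<phi> \<and> smooth_function_along A M W \<psi> \<and>
     (\<forall>q\<in>W. \<forall>v\<in>tangent_sub A M q.
        shape_N A g D M \<xi> N q v =
          \<phi> q *\<^sub>R shape_\<xi> A g D M \<xi> N q v + \<psi> q *\<^sub>R screen_proj A g M S q v)"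

end

theory Submission
  imports Defs "HOL-Computational_Algebra.Polynomial"
begin

text \<open>
  Extend an eigenframe \<open>E\<^sub>1, \<dots>, E\<^sub>n, \<xi>, N\<close> near \<open>p\<close> to vector fields of the ambient manifold and write
  \<open>\<Gamma>\<^sub>i\<^sub>j\<^sub>k = g(D\<^bsub>E\<^sub>i\<^esub> E\<^sub>j, E\<^sub>k)\<close>, \<open>C\<^sub>i\<^sub>j = g(D\<^bsub>E\<^sub>i\<^esub> E\<^sub>j, N)\<close>. Since the \<open>\<kappa>\<^sub>j\<close> are constant along the screen,
  the Codazzi equations \<open>g(R(E\<^sub>i,E\<^sub>j)\<xi>, E\<^sub>k) = 0\<close> and \<open>g(R(\<xi>,E\<^sub>j)\<xi>, E\<^sub>k) = 0\<close> say that
  \<open>Q\<^sub>i\<^sub>j\<^sub>k = (\<kappa>\<^sub>k - \<kappa>\<^sub>j) \<Gamma>\<^sub>i\<^sub>j\<^sub>k\<close> is totally symmetric and that \<open>(\<kappa>\<^sub>k - \<kappa>\<^sub>j) g(D\<^bsub>\<xi>\<^esub> E\<^sub>j, E\<^sub>k) = 0\<close>. The Gauss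
  equation \<open>g(R(E\<^sub>i,E\<^sub>j)E\<^sub>j, E\<^sub>i) = c\<close> then becomes
  \<open>c + \<kappa>\<^sub>i C\<^sub>j\<^sub>j + \<kappa>\<^sub>j C\<^sub>i\<^sub>i = \<Sum>\<^sub>k 2 Q\<^sub>i\<^sub>j\<^sub>k\<^sup>2 / ((\<kappa>\<^sub>k - \<kappa>\<^sub>i)(\<kappa>\<^sub>k - \<kappa>\<^sub>j))\<close>. After division by \<open>\<kappa>\<^sub>i - \<kappa>\<^sub>j\<close> the right-hand
  side is antisymmetric in \<open>j\<close> and \<open>k\<close>, so its sum over \<open>j\<close> vanishes. Multiplicities of the \<open>\<kappa>\<^sub>j\<close> need
  not be locally constant: at \<open>p\<close> the derivatives of those \<open>\<Gamma>\<close> that enter the Gauss equation are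
  controlled by differentiating the Codazzi equation itself.
\<close>

section \<open>Smooth functions\<close>

lemma Ck_on_Suc_imp: "Ck_on (Suc k) U f \<Longrightarrow> Ck_on k U f"
proof (induction k arbitrary: f)
  case 0
  then show ?case
    by (auto intro!: continuous_at_imp_continuous_on intro: has_derivative_continuous)
next
  case (Suc k)
  from Suc.prems obtain f' where
    "\<forall>x\<in>U. (f has_derivative f' x) (at x)" "\<forall>v. Ck_on (Suc k) U (\<lambda>x. f' x v)"
    by auto
  with Suc.IH show ?case by (subst Ck_on.simps) blast
qed

lemma Ck_on_const: "Ck_on k U (\<lambda>x. a)"
proof (induction k arbitrary: a)
  case (Suc k)
  then show ?case by (auto intro!: exI[of _ "\<lambda>x v. 0"])
qed simp

lemma Ck_on_linear_comb:
  fixes f h :: "'a::euclidean_space \<Rightarrow> real"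
  shows "Ck_on k U f \<Longrightarrow> Ck_on k U h \<Longrightarrow> Ck_on k U (\<lambda>x. a * f x + b * h x)"
proof (induction k arbitrary: f h)
  case 0
  then show ?case by (auto intro!: continuous_intros)
next
  case (Suc k)
  from Suc.prems obtain f' h' where
    *: "\<forall>x\<in>U. (f has_derivative f' x) (at x)" "\<forall>v. Ck_on k U (\<lambda>x. f' x v)"
    "\<forall>x\<in>U. (h has_derivative h' x) (at x)" "\<forall>v. Ck_on k U (\<lambda>x. h' x v)"
    by auto
  have "\<forall>x\<in>U. ((\<lambda>x. a * f x + b * h x) has_derivative (\<lambda>v. a * f' x v + b * h' x v)) (at x)"
    using * by (auto intro!: derivative_eq_intros)
  moreover have "\<forall>v. Ck_on k U (\<lambda>x. a * f' x v + b * h' x v)"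
    using * Suc.IH by blast
  ultimately show ?case by (subst Ck_on.simps) (rule exI[of _ "\<lambda>x v. a * f' x v + b * h' x v"], blast)
qed

lemma Ck_on_mult:
  fixes f h :: "'a::euclidean_space \<Rightarrow> real"
  shows "Ck_on k U f \<Longrightarrow> Ck_on k U h \<Longrightarrow> Ck_on k U (\<lambda>x. f x * h x)"
proof (induction k arbitrary: f h)
  case 0
  then show ?case by (auto intro!: continuous_intros)
next
  case (Suc k)
  from Suc.prems obtain f' h' where
    *: "\<forall>x\<in>U. (f has_derivative f' x) (at x)" "\<forall>v. Ck_on k U (\<lambda>x. f' x v)"
    "\<forall>x\<in>U. (h has_derivative h' x) (at x)" "\<forall>v. Ck_on k U (\<lambda>x. h' x v)"
    by auto
  \<comment> \<open>The product rule brings back \<open>f\<close> and \<open>h\<close> next to their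
    derivatives, so both also enter at the lower order \<open>k\<close>.\<close>
  have fh: "Ck_on k U f" "Ck_on k U h"
    using Suc.prems by (auto dest: Ck_on_Suc_imp simp del: Ck_on.simps)
  let ?d = "\<lambda>x v. f x * h' x v + f' x v * h x"
  have "\<forall>x\<in>U. ((\<lambda>x. f x * h x) has_derivative ?d x) (at x)"
    using * by (auto intro!: has_derivative_mult)
  moreover have "Ck_on k U (\<lambda>x. ?d x v)" for v
    using Ck_on_linear_comb[of k U "\<lambda>x. f x * h' x v" "\<lambda>x. f' x v * h x" 1 1] * fh Suc.IH by simp
  ultimately show ?case by (subst Ck_on.simps) (rule exI[of _ ?d], blast)
qed

lemma smooth_functions_const: "(\<lambda>q. a) \<in> smooth_functions A"
  by (auto simp: smooth_functions_def smooth_on_def o_def Ck_on_const)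

lemma smooth_functions_linear_comb:
  "f \<in> smooth_functions A \<Longrightarrow> h \<in> smooth_functions A \<Longrightarrow>
    (\<lambda>q. a * f q + b * h q) \<in> smooth_functions A"
  by (simp add: smooth_functions_def smooth_on_def o_def case_prod_unfold Ck_on_linear_comb)

lemma smooth_functions_diff:
  "f \<in> smooth_functions A \<Longrightarrow> h \<in> smooth_functions A \<Longrightarrow> (\<lambda>q. f q - h q) \<in> smooth_functions A"
  using smooth_functions_linear_comb[of f A h 1 "- 1"] by simp

lemma smooth_functions_uminus:
  "f \<in> smooth_functions A \<Longrightarrow> (\<lambda>q. - f q) \<in> smooth_functions A"
  using smooth_functions_linear_comb[of f A f "- 1" 0] by simp

lemma smooth_functions_mult:
  "f \<in> smooth_functions A \<Longrightarrow> h \<in> smooth_functions A \<Longrightarrow> (\<lambda>q. f q * h q) \<in> smooth_functions A"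
  by (simp add: smooth_functions_def smooth_on_def o_def case_prod_unfold Ck_on_mult)


section \<open>Curvature-like tensors\<close>

text \<open>
  A degenerate plane is a limit of the nondegenerate planes spanned by \<open>x + t u\<close>, \<open>y + t w\<close>:
  the Gram determinant of the latter is a polynomial in \<open>t\<close> with \<open>t\<^sup>4\<close>-coefficient \<open>-1\<close>.
\<close>

lemma curvature_like_eq_0:
  fixes F :: "'v::real_vector \<Rightarrow> 'v \<Rightarrow> 'v \<Rightarrow> 'v \<Rightarrow> real" and b :: "'v \<Rightarrow> 'v \<Rightarrow> real"
  assumes V: "subspace V"
    and lin: "\<And>x x' y z w s t. \<lbrakk>x \<in> V; x' \<in> V; y \<in> V; z \<in> V; w \<in> V\<rbrakk> \<Longrightarrow>
      F (s *\<^sub>R x + t *\<^sub>R x') y z w = s * F x y z w + t * F x' y z w"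
    and skew: "\<And>x y z w. \<lbrakk>x \<in> V; y \<in> V; z \<in> V; w \<in> V\<rbrakk> \<Longrightarrow> F x y z w = - F y x z w"
    and skew': "\<And>x y z w. \<lbrakk>x \<in> V; y \<in> V; z \<in> V; w \<in> V\<rbrakk> \<Longrightarrow> F x y z w = - F x y w z"
    and bianchi: "\<And>x y z w. \<lbrakk>x \<in> V; y \<in> V; z \<in> V; w \<in> V\<rbrakk> \<Longrightarrow>
      F x y z w + F y z x w + F z x y w = 0"
    and b_sym: "\<And>x y. \<lbrakk>x \<in> V; y \<in> V\<rbrakk> \<Longrightarrow> b x y = b y x"
    and b_lin: "\<And>x x' y s t. \<lbrakk>x \<in> V; x' \<in> V; y \<in> V\<rbrakk> \<Longrightarrow>
      b (s *\<^sub>R x + t *\<^sub>R x') y = s * b x y + t * b x' y"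
    and sec: "\<And>x y. \<lbrakk>x \<in> V; y \<in> V; b x x * b y y - (b x y)\<^sup>2 \<noteq> 0\<rbrakk> \<Longrightarrow> F x y y x = 0"
    and null: "u0 \<in> V" "w0 \<in> V" "b u0 u0 = 0" "b w0 w0 = 0" "b u0 w0 = 1"
    and xyzw: "x \<in> V" "y \<in> V" "z \<in> V" "w \<in> V"
  shows "F x y z w = 0"
proof -
  \<comment> \<open>The four Bianchi identities on cyclic shifts, combined with skewness in each
    pair, exchange the two pairs. Linearity in the first slot then spreads to all slots.\<close>
  have pair: "F x y z w = F z w x y" if "x \<in> V" "y \<in> V" "z \<in> V" "w \<in> V" for x y z w
    using bianchi[OF that(1,2,3,4)] bianchi[OF that(2,3,4,1)] bianchi[OF that(3,4,1,2)] bianchi[OF that(4,1,2,3)]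
      skew'[OF that(2,3,4,1)] skew'[OF that(3,4,2,1)] skew[OF that(4,2,3,1)] skew[OF that(4,1,3,2)] skew'[OF that(1,4,3,2)]
      skew[OF that(1,3,4,2)] skew'[OF that(3,1,4,2)] skew[OF that(4,1,2,3)] skew'[OF that(1,2,4,3)] skew'[OF that(2,4,1,3)]
    by linarith
  have add: "F (x + t *\<^sub>R x') y z w = F x y z w + t * F x' y z w"
    if "x \<in> V" "x' \<in> V" "y \<in> V" "z \<in> V" "w \<in> V" for x x' y z w t
    using lin[of x x' y z w 1 t] that by simp
  have mem: "x + t *\<^sub>R x' \<in> V" if "x \<in> V" "x' \<in> V" for x x' t
    using V that by (simp add: subspace_add subspace_scale)
  have add2: "F y (x + t *\<^sub>R x') z w = F y x z w + t * F y x' z w"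
    if "x \<in> V" "x' \<in> V" "y \<in> V" "z \<in> V" "w \<in> V" for x x' y z w t
    using add[of x x' y z w t] skew[of y "x + t *\<^sub>R x'" z w] skew[of y x z w] skew[of y x' z w] that mem
    by (simp add: algebra_simps)
  have add3: "F y z (x + t *\<^sub>R x') w = F y z x w + t * F y z x' w"
    if "x \<in> V" "x' \<in> V" "y \<in> V" "z \<in> V" "w \<in> V" for x x' y z w t
    using add[of x x' w y z t] pair[of y z "x + t *\<^sub>R x'" w] pair[of y z x w] pair[of y z x' w] that mem
    by simp
  have add4: "F y z w (x + t *\<^sub>R x') = F y z w x + t * F y z w x'"
    if "x \<in> V" "x' \<in> V" "y \<in> V" "z \<in> V" "w \<in> V" for x x' y z w t
    using add2[of x x' w y z t] pair[of y z w "x + t *\<^sub>R x'"] pair[of y z w x] pair[of y z w x'] that mem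
    by simp
  note adds = add add2 add3 add4
  have b_add: "b (x + t *\<^sub>R x') y = b x y + t * b x' y" if "x \<in> V" "x' \<in> V" "y \<in> V" for x x' y t
    using b_lin[of x x' y 1 t] that by simp
  have b_add2: "b y (x + t *\<^sub>R x') = b y x + t * b y x'" if "x \<in> V" "x' \<in> V" "y \<in> V" for x x' y t
    using b_add[of x x' y t] b_sym[of y] that mem by simp
  have sec0: "F x y y x = 0" if [simp]: "x \<in> V" "y \<in> V" for x y
  proof -
    note [simp] = null
    let ?f = "\<lambda>t. F (x + t *\<^sub>R u0) (y + t *\<^sub>R w0) (y + t *\<^sub>R w0) (x + t *\<^sub>R u0)"
    \<comment> \<open>The coefficients of \<open>?f\<close> in powers of \<open>t\<close>, by
      multilinear expansion; the constant one is the value sought.\<close>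
    define P where "P = [: F x y y x,
      F u0 y y x + F x w0 y x + F x y w0 x + F x y y u0,
      F u0 w0 y x + F u0 y w0 x + F u0 y y u0 + F x w0 w0 x + F x w0 y u0 + F x y w0 u0,
      F u0 w0 w0 x + F u0 w0 y u0 + F u0 y w0 u0 + F x w0 w0 u0,
      F u0 w0 w0 u0 :]"
    have f: "?f t = poly P t" for t
      unfolding P_def by (simp only: adds mem that null poly_pCons poly_0) algebra
    \<comment> \<open>Nullity of \<open>u0\<close> and \<open>w0\<close> leaves the two diagonal
      Gram entries linear in \<open>t\<close>, while \<open>b u0 w0 = 1\<close> makes the
      off-diagonal entry a monic quadratic.\<close>
    define G where "G = [: b x x, 2 * b x u0 :] * [: b y y, 2 * b y w0 :]
      - [: b x y, b x w0 + b u0 y, 1 :]\<^sup>2"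
    have G: "b (x + t *\<^sub>R u0) (x + t *\<^sub>R u0) * b (y + t *\<^sub>R w0) (y + t *\<^sub>R w0)
      - (b (x + t *\<^sub>R u0) (y + t *\<^sub>R w0))\<^sup>2 = poly G t" for t
      using b_sym[of u0 x] b_sym[of w0 y]
      unfolding G_def
      by (simp add: b_add b_add2 mem) (simp add: power2_eq_square algebra_simps)
    have "coeff G 4 = - 1"
      by (simp add: G_def power2_eq_square numeral_eq_Suc)
    then have "G \<noteq> 0" by auto
    \<comment> \<open>For each \<open>t\<close> either the plane is nondegenerate and
      \<open>sec\<close> annihilates \<open>P\<close>, or \<open>G\<close> vanishes. Real
      polynomials have no zero divisors, so \<open>P\<close> itself is zero.\<close>
    moreover have "poly (P * G) t = 0" for t
      using sec[of "x + t *\<^sub>R u0" "y + t *\<^sub>R w0"] mem G[of t] f[of t] by auto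
    then have "P * G = 0" using poly_all_0_iff_0 by blast
    ultimately have "P = 0" by simp
    then show ?thesis by (simp add: P_def)
  qed
  \<comment> \<open>Polarization in the two outer slots; \<open>s2\<close> repeats it in the two
    middle ones.\<close>
  have s1: "F x y y z = 0" if "x \<in> V" "y \<in> V" "z \<in> V" for x y z
  proof -
    have m: "x + 1 *\<^sub>R z \<in> V" by (intro mem that)
    have "F (x + 1 *\<^sub>R z) y y (x + 1 *\<^sub>R z) = F x y y x + F x y y z + F z y y x + F z y y z"
      using add[OF that(1,3,2,2) m, of 1] add4[OF that(1,3,1,2,2), of 1] add4[OF that(1,3,3,2,2), of 1]
      by linarith
    moreover have "F z y y x = F x y y z"
      using pair[OF that(3,2,2,1)] skew[OF that(2,1,3,2)] skew'[OF that(1,2,3,2)] by linarith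
    ultimately show ?thesis
      using sec0[OF that(1,2)] sec0[OF that(3,2)] sec0[OF m that(2)] by linarith
  qed
  have s2: "F x y z w = - F x z y w" if "x \<in> V" "y \<in> V" "z \<in> V" "w \<in> V" for x y z w
  proof -
    have m: "y + 1 *\<^sub>R z \<in> V" by (intro mem that)
    show ?thesis
      using s1[OF that(1) m that(4)] s1[OF that(1,2,4)] s1[OF that(1,3,4)]
        add2[OF that(2,3,1) m that(4), of 1] add3[OF that(2,3,1,2,4), of 1] add3[OF that(2,3,1,3,4), of 1]
      by linarith
  qed
  \<comment> \<open>\<open>F\<close> is now alternating in its first three arguments, so the Bianchi
    sum is three times \<open>F x y z w\<close>.\<close>
  show ?thesis
    using bianchi[OF xyzw(1,2,3,4)] s2[OF xyzw(1,2,3,4)] s2[OF xyzw(2,3,1,4)] s2[OF xyzw(3,1,2,4)] skew[OF xyzw(1,3,2,4)]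
      skew[OF xyzw(2,1,3,4)] skew[OF xyzw(3,2,1,4)]
    by linarith
qed

section \<open>Constant curvature\<close>

lemma lie_bracket_apply: "lie_bracket X Y p f = X p (\<lambda>q. Y q f) - Y p (\<lambda>q. X q f)"
  by (simp add: lie_bracket_def)

lemma tangent_linear_comb:
  "\<lbrakk>v \<in> tangent_space A p; f \<in> smooth_functions A; h \<in> smooth_functions A\<rbrakk> \<Longrightarrow>
    v (\<lambda>q. a * f q + b * h q) = a * v f + b * v h"
  by (simp add: tangent_space_def)

lemma tangent_mult:
  "\<lbrakk>v \<in> tangent_space A p; f \<in> smooth_functions A; h \<in> smooth_functions A\<rbrakk> \<Longrightarrow>
    v (\<lambda>q. f q * h q) = f p * v h + h p * v f"
  by (simp add: tangent_space_def)

lemma tangent_nonsmooth: "\<lbrakk>v \<in> tangent_space A p; f \<notin> smooth_functions A\<rbrakk> \<Longrightarrow> v f = 0"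
  by (simp add: tangent_space_def)

lemma tangent_add:
  "\<lbrakk>v \<in> tangent_space A p; f \<in> smooth_functions A; h \<in> smooth_functions A\<rbrakk> \<Longrightarrow>
    v (\<lambda>q. f q + h q) = v f + v h"
  using tangent_linear_comb[of v A p f h 1 1] by simp

lemma tangent_diff:
  "\<lbrakk>v \<in> tangent_space A p; f \<in> smooth_functions A; h \<in> smooth_functions A\<rbrakk> \<Longrightarrow>
    v (\<lambda>q. f q - h q) = v f - v h"
  using tangent_linear_comb[of v A p f h 1 "- 1"] by simp

lemma tangent_uminus:
  "\<lbrakk>v \<in> tangent_space A p; f \<in> smooth_functions A\<rbrakk> \<Longrightarrow> v (\<lambda>q. - f q) = - v f"
  using tangent_linear_comb[of v A p f f "- 1" 0] by simp

text \<open>The Leibniz rule on 1 = 1 * 1 makes \<open>v\<close> vanish at the constant 1; linearity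
  does the rest.\<close>

lemma tangent_const: "v \<in> tangent_space A p \<Longrightarrow> v (\<lambda>q. a) = 0"
  using tangent_mult[of v A p "\<lambda>q. 1" "\<lambda>q. 1"]
    tangent_linear_comb[of v A p "\<lambda>q. 1" "\<lambda>q. 1" a 0]
  by (simp add: smooth_functions_const)

lemma subspace_tangent_space: "subspace (tangent_space A p)"
  unfolding subspace_def tangent_space_def
  by (auto simp: scaleR_fun_def algebra_simps)

lemma subspace_linear_comb: "subspace S \<Longrightarrow> u \<in> S \<Longrightarrow> v \<in> S \<Longrightarrow> a *\<^sub>R u + b *\<^sub>R v \<in> S"
  by (simp add: subspace_add subspace_scale)

lemmas tangent_space_closed =
  subspace_add[OF subspace_tangent_space] subspace_diff[OF subspace_tangent_space]
  subspace_scale[OF subspace_tangent_space] subspace_neg[OF subspace_tangent_space]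
  subspace_0[OF subspace_tangent_space] subspace_sum[OF subspace_tangent_space]

lemma vector_fields_tangent: "X \<in> vector_fields A \<Longrightarrow> X p \<in> tangent_space A p"
  by (simp add: vector_fields_def)

lemma vector_fields_smooth:
  "X \<in> vector_fields A \<Longrightarrow> f \<in> smooth_functions A \<Longrightarrow> (\<lambda>p. X p f) \<in> smooth_functions A"
  by (simp add: vector_fields_def)

lemma vector_fields_linear_comb:
  "X \<in> vector_fields A \<Longrightarrow> Y \<in> vector_fields A \<Longrightarrow>
    (\<lambda>q. a *\<^sub>R X q + b *\<^sub>R Y q) \<in> vector_fields A"
  using smooth_functions_linear_comb[of "\<lambda>q. X q _" A "\<lambda>q. Y q _" a b]
    subspace_linear_comb[OF subspace_tangent_space, of "X _" A _ "Y _" a b]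
  by (auto simp: vector_fields_def scaleR_fun_def[of _ "_ _"])

lemma vector_fields_diff:
  "X \<in> vector_fields A \<Longrightarrow> Y \<in> vector_fields A \<Longrightarrow> (\<lambda>q. X q - Y q) \<in> vector_fields A"
  using vector_fields_linear_comb[of X A Y 1 "- 1"] by simp

lemma vector_fields_zero: "(\<lambda>q. 0) \<in> vector_fields A"
  by (simp add: vector_fields_def tangent_space_closed smooth_functions_const)

text \<open>Lets entire vector fields, rather than their values at a point, play the role of vectors
  in \<open>curvature_like_eq_0\<close>.\<close>

lemma subspace_vector_fields: "subspace (vector_fields A)"
proof (rule subspaceI)
  show "0 \<in> vector_fields A" using vector_fields_zero by (simp add: zero_fun_def)
  show "X + Y \<in> vector_fields A" if "X \<in> vector_fields A" "Y \<in> vector_fields A" for X Y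
    using vector_fields_linear_comb[of X A Y 1 1] that by (simp add: plus_fun_def)
  show "a *\<^sub>R X \<in> vector_fields A" if "X \<in> vector_fields A" for X a
    using vector_fields_linear_comb[of X A X a 0] that by (simp add: scaleR_fun_def[of a X])
qed

section \<open>Metric and Levi-Civita connection\<close>

locale lorentz_space =
  fixes A :: "('m::topological_space, 'a::euclidean_space) atlas"
    and g :: "'m metric" and D :: "'m connection"
  assumes lorentz: "lorentzian_metric A g" and lc: "levi_civita A g D"
begin

lemma g_sym: "\<lbrakk>u \<in> tangent_space A p; v \<in> tangent_space A p\<rbrakk> \<Longrightarrow> g p u v = g p v u"
  using lorentz unfolding lorentzian_metric_def by blast

lemma g_linear_comb_left:
  "\<lbrakk>u \<in> tangent_space A p; v \<in> tangent_space A p; w \<in> tangent_space A p\<rbrakk> \<Longrightarrow>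
    g p (a *\<^sub>R u + b *\<^sub>R v) w = a * g p u w + b * g p v w"
  using lorentz unfolding lorentzian_metric_def by blast

lemma
  assumes "u \<in> tangent_space A p" "v \<in> tangent_space A p" "w \<in> tangent_space A p"
  shows g_add_left: "g p (u + v) w = g p u w + g p v w"
    and g_diff_left: "g p (u - v) w = g p u w - g p v w"
  using g_linear_comb_left[OF assms, of 1 1] g_linear_comb_left[OF assms, of 1 "- 1"] by simp_all

lemma g_scale_left:
  "\<lbrakk>u \<in> tangent_space A p; w \<in> tangent_space A p\<rbrakk> \<Longrightarrow> g p (a *\<^sub>R u) w = a * g p u w"
  using g_linear_comb_left[of u p u w a 0] by simp

lemma g_uminus_left:
  "\<lbrakk>u \<in> tangent_space A p; w \<in> tangent_space A p\<rbrakk> \<Longrightarrow> g p (- u) w = - g p u w"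
  using g_scale_left[of u p w "- 1"] by simp

lemma g_zero_left: "w \<in> tangent_space A p \<Longrightarrow> g p 0 w = 0"
  using g_scale_left[of w p w 0] by simp

lemma g_sum_left:
  assumes "\<And>i. i \<in> I \<Longrightarrow> u i \<in> tangent_space A p" "w \<in> tangent_space A p"
  shows "g p (\<Sum>i\<in>I. u i) w = (\<Sum>i\<in>I. g p (u i) w)"
  using assms(1)
proof (induction I rule: infinite_finite_induct)
  case (insert i I)
  have "g p (u i + (\<Sum>i\<in>I. u i)) w = g p (u i) w + g p (\<Sum>i\<in>I. u i) w"
    using insert.prems assms(2) by (intro g_add_left tangent_space_closed(6)) auto
  moreover have "g p (\<Sum>i\<in>I. u i) w = (\<Sum>i\<in>I. g p (u i) w)"
    using insert by blast
  ultimately show ?case by (simp only: sum.insert[OF insert.hyps])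
qed (use g_zero_left[OF assms(2)] in auto)

lemma g_smooth:
  "\<lbrakk>X \<in> vector_fields A; Y \<in> vector_fields A\<rbrakk> \<Longrightarrow> (\<lambda>p. g p (X p) (Y p)) \<in> smooth_functions A"
  using lorentz unfolding lorentzian_metric_def by blast

lemma connection: "affine_connection A D"
  using lc by (simp add: levi_civita_def)

lemma D_tangent: "\<lbrakk>v \<in> tangent_space A p; Y \<in> vector_fields A\<rbrakk> \<Longrightarrow> D p v Y \<in> tangent_space A p"
  using connection unfolding affine_connection_def by blast

lemma D_field:
  "\<lbrakk>X \<in> vector_fields A; Y \<in> vector_fields A\<rbrakk> \<Longrightarrow> (\<lambda>p. D p (X p) Y) \<in> vector_fields A"
  using connection unfolding affine_connection_def by blast

lemma D_linear_comb_dir: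
  "\<lbrakk>u \<in> tangent_space A p; v \<in> tangent_space A p; Y \<in> vector_fields A\<rbrakk> \<Longrightarrow>
    D p (a *\<^sub>R u + b *\<^sub>R v) Y = a *\<^sub>R D p u Y + b *\<^sub>R D p v Y"
  using connection unfolding affine_connection_def by blast

lemma D_add_dir:
  "\<lbrakk>u \<in> tangent_space A p; v \<in> tangent_space A p; Y \<in> vector_fields A\<rbrakk> \<Longrightarrow>
    D p (u + v) Y = D p u Y + D p v Y"
  using D_linear_comb_dir[of u p v Y 1 1] by simp

lemma D_scale_dir:
  "\<lbrakk>u \<in> tangent_space A p; Y \<in> vector_fields A\<rbrakk> \<Longrightarrow> D p (a *\<^sub>R u) Y = a *\<^sub>R D p u Y"
  using D_linear_comb_dir[of u p u Y a 0] by simp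

lemma D_zero_dir: "Y \<in> vector_fields A \<Longrightarrow> D p 0 Y = 0"
  using D_scale_dir[of 0 p Y 0] by (simp add: tangent_space_closed)

lemma D_sum_dir:
  assumes "\<And>i. i \<in> I \<Longrightarrow> u i \<in> tangent_space A p" "Y \<in> vector_fields A"
  shows "D p (\<Sum>i\<in>I. u i) Y = (\<Sum>i\<in>I. D p (u i) Y)"
  using assms(1)
proof (induction I rule: infinite_finite_induct)
  case (insert i I)
  have "D p (u i + (\<Sum>i\<in>I. u i)) Y = D p (u i) Y + D p (\<Sum>i\<in>I. u i) Y"
    using insert.prems assms(2) by (intro D_add_dir tangent_space_closed(6)) auto
  moreover have "D p (\<Sum>i\<in>I. u i) Y = (\<Sum>i\<in>I. D p (u i) Y)"
    using insert by blast
  ultimately show ?case by (simp only: sum.insert[OF insert.hyps])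
qed (use D_zero_dir[OF assms(2)] in auto)

lemma D_leibniz:
  "\<lbrakk>v \<in> tangent_space A p; f \<in> smooth_functions A; Y \<in> vector_fields A\<rbrakk> \<Longrightarrow>
    D p v (\<lambda>q. f q *\<^sub>R Y q) = v f *\<^sub>R Y p + f p *\<^sub>R D p v Y"
  using connection unfolding affine_connection_def by blast

lemma D_add:
  "\<lbrakk>v \<in> tangent_space A p; X \<in> vector_fields A; Y \<in> vector_fields A\<rbrakk> \<Longrightarrow>
    D p v (\<lambda>q. X q + Y q) = D p v X + D p v Y"
  using connection unfolding affine_connection_def by blast

lemma D_linear_comb:
  assumes v: "v \<in> tangent_space A p" and X: "X \<in> vector_fields A" and Y: "Y \<in> vector_fields A"
  shows "D p v (\<lambda>q. a *\<^sub>R X q + b *\<^sub>R Y q) = a *\<^sub>R D p v X + b *\<^sub>R D p v Y"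
proof -
  have s: "D p v (\<lambda>q. a *\<^sub>R X q) = a *\<^sub>R D p v X" if "X \<in> vector_fields A" for X a
  proof -
    have "D p v (\<lambda>q. a *\<^sub>R X q) = v (\<lambda>q. a) *\<^sub>R X p + a *\<^sub>R D p v X"
      by (rule D_leibniz[OF v smooth_functions_const that])
    then show ?thesis using v by (simp add: tangent_const)
  qed
  have m: "(\<lambda>q. a *\<^sub>R X q) \<in> vector_fields A" if "X \<in> vector_fields A" for X a
    using vector_fields_linear_comb[OF that that, of a 0] by simp
  have "D p v (\<lambda>q. a *\<^sub>R X q + b *\<^sub>R Y q) = D p v (\<lambda>q. a *\<^sub>R X q) + D p v (\<lambda>q. b *\<^sub>R Y q)"
    by (rule D_add[OF v m[OF X] m[OF Y]])
  then show ?thesis using s X Y by simp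
qed

lemma D_diff:
  "\<lbrakk>v \<in> tangent_space A p; X \<in> vector_fields A; Y \<in> vector_fields A\<rbrakk> \<Longrightarrow>
    D p v (\<lambda>q. X q - Y q) = D p v X - D p v Y"
  using D_linear_comb[of v p X Y 1 "- 1"] by simp

lemma torsion_free:
  "\<lbrakk>X \<in> vector_fields A; Y \<in> vector_fields A\<rbrakk> \<Longrightarrow>
    lie_bracket X Y p = D p (X p) Y - D p (Y p) X"
  using lc by (simp add: levi_civita_def)

lemma D_metric:
  "\<lbrakk>v \<in> tangent_space A p; Y \<in> vector_fields A; Z \<in> vector_fields A\<rbrakk> \<Longrightarrow>
    v (\<lambda>q. g q (Y q) (Z q)) = g p (D p v Y) (Z p) + g p (Y p) (D p v Z)"
  using lc by (simp add: levi_civita_def)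

text \<open>Torsion-freeness exhibits the bracket as a difference of two covariant derivatives of
  fields, which replaces a direct check of the Leibniz rule for commutators.\<close>

lemma lie_bracket_field:
  "\<lbrakk>X \<in> vector_fields A; Y \<in> vector_fields A\<rbrakk> \<Longrightarrow> lie_bracket X Y \<in> vector_fields A"
  using vector_fields_diff[OF D_field D_field, of X Y Y X]
    torsion_free[of X Y, THEN ext[of "lie_bracket X Y"]] by metis

lemmas tangentI = vector_fields_tangent D_tangent D_field lie_bracket_field tangent_space_closed

section \<open>Symmetries of the curvature tensor\<close>

lemma jacobi:
  assumes X: "X \<in> vector_fields A" and Y: "Y \<in> vector_fields A" and Z: "Z \<in> vector_fields A"
  shows "lie_bracket X (lie_bracket Y Z) p + lie_bracket Y (lie_bracket Z X) p
    + lie_bracket Z (lie_bracket X Y) p = 0"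
proof
  fix f
  \<comment> \<open>Each double bracket expands into four iterated derivatives of \<open>f\<close>;
    the twelve in the cyclic sum cancel.\<close>
  have L: "lie_bracket U (lie_bracket V W) p f =
      U p (\<lambda>q. V q (\<lambda>r. W r f)) - U p (\<lambda>q. W q (\<lambda>r. V r f))
      - (V p (\<lambda>q. W q (\<lambda>r. U r f)) - W p (\<lambda>q. V q (\<lambda>r. U r f)))"
    if "f \<in> smooth_functions A" "U \<in> vector_fields A" "V \<in> vector_fields A" "W \<in> vector_fields A"
    for U V W
  proof -
    have "U p (\<lambda>q. V q (\<lambda>r. W r f) - W q (\<lambda>r. V r f)) =
        U p (\<lambda>q. V q (\<lambda>r. W r f)) - U p (\<lambda>q. W q (\<lambda>r. V r f))"
      by (rule tangent_diff[OF vector_fields_tangent[OF that(2)]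
            vector_fields_smooth[OF that(3) vector_fields_smooth[OF that(4,1)]]
            vector_fields_smooth[OF that(4) vector_fields_smooth[OF that(3,1)]]])
    then show ?thesis by (simp only: lie_bracket_apply)
  qed
  show "(lie_bracket X (lie_bracket Y Z) p + lie_bracket Y (lie_bracket Z X) p
    + lie_bracket Z (lie_bracket X Y) p) f = 0 f"
  proof (cases "f \<in> smooth_functions A")
    case True
    from L[OF this X Y Z] L[OF this Y Z X] L[OF this Z X Y] show ?thesis by simp
  next
    \<comment> \<open>Tangent vectors are zero on nonsmooth functions by convention; equality in HOL
      has to cover these as well.\<close>
    case False
    have "lie_bracket U (lie_bracket V W) p f = 0"
      if "U \<in> vector_fields A" "V \<in> vector_fields A" "W \<in> vector_fields A" for U V W
      by (rule tangent_nonsmooth[OF vector_fields_tangent[OF lie_bracket_field] False])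
        (intro lie_bracket_field that)+
    with X Y Z show ?thesis by simp
  qed
qed

lemma curvature_tangent:
  "\<lbrakk>X \<in> vector_fields A; Y \<in> vector_fields A; Z \<in> vector_fields A\<rbrakk> \<Longrightarrow>
    curvature D X Y Z p \<in> tangent_space A p"
  unfolding curvature_def by (intro tangentI)

lemma lie_bracket_skew: "lie_bracket X Y p = - lie_bracket Y X p"
  by (rule ext) (simp add: lie_bracket_apply)

lemma D_uminus_dir:
  "\<lbrakk>u \<in> tangent_space A p; Y \<in> vector_fields A\<rbrakk> \<Longrightarrow> D p (- u) Y = - D p u Y"
  using D_scale_dir[of u p Y "- 1"] by simp

lemma curvature_skew:
  "\<lbrakk>X \<in> vector_fields A; Y \<in> vector_fields A; Z \<in> vector_fields A\<rbrakk> \<Longrightarrow>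
    curvature D X Y Z p = - curvature D Y X Z p"
  unfolding curvature_def
  by (subst lie_bracket_skew[of X Y]) (simp add: D_uminus_dir tangentI)

lemma curvature_linear_comb:
  assumes X: "X \<in> vector_fields A" and X': "X' \<in> vector_fields A"
    and Y: "Y \<in> vector_fields A" and Z: "Z \<in> vector_fields A"
  shows "curvature D (\<lambda>q. a *\<^sub>R X q + b *\<^sub>R X' q) Y Z p =
    a *\<^sub>R curvature D X Y Z p + b *\<^sub>R curvature D X' Y Z p"
proof -
  have "lie_bracket (\<lambda>q. a *\<^sub>R X q + b *\<^sub>R X' q) Y p =
      a *\<^sub>R lie_bracket X Y p + b *\<^sub>R lie_bracket X' Y p"
    using assms by (simp add: torsion_free D_linear_comb D_linear_comb_dir vector_fields_linear_comb
        vector_fields_tangent algebra_simps)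
  with assms show ?thesis
    unfolding curvature_def
    by (simp add: D_linear_comb D_linear_comb_dir tangentI algebra_simps)
qed

text \<open>Torsion-freeness, used twice, turns differences of second covariant derivatives into
  double brackets plus exactly the bracket terms of the curvature. The cyclic sum is then the Jacobi
  identity.\<close>

lemma curvature_bianchi:
  assumes X: "X \<in> vector_fields A" and Y: "Y \<in> vector_fields A" and Z: "Z \<in> vector_fields A"
  shows "curvature D X Y Z p + curvature D Y Z X p + curvature D Z X Y p = 0"
proof -
  have d: "D p (U p) (\<lambda>q. D q (V q) W) - D p (U p) (\<lambda>q. D q (W q) V) =
      lie_bracket U (lie_bracket V W) p + D p (lie_bracket V W p) U"
    if "U \<in> vector_fields A" "V \<in> vector_fields A" "W \<in> vector_fields A" for U V W
  proof -
    have "lie_bracket V W = (\<lambda>q. D q (V q) W - D q (W q) V)"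
      using that torsion_free by (intro ext) simp
    then have "D p (U p) (lie_bracket V W) = D p (U p) (\<lambda>q. D q (V q) W) - D p (U p) (\<lambda>q. D q (W q) V)"
      using that by (simp add: D_diff tangentI)
    then show ?thesis using that torsion_free[of U "lie_bracket V W" p] by (simp add: tangentI)
  qed
  show ?thesis
    using d[OF X Y Z] d[OF Y Z X] d[OF Z X Y] jacobi[OF X Y Z, of p]
    unfolding curvature_def by (simp add: algebra_simps)
qed

text \<open>Metric compatibility moves the outer derivative off the field, leaving derivatives of
  scalar functions and products of first covariant derivatives. The Codazzi and Gauss equations are
  read off in this form.\<close>

lemma curvature_pairing:
  assumes X: "X \<in> vector_fields A" and Y: "Y \<in> vector_fields A"
    and Z: "Z \<in> vector_fields A" and W: "W \<in> vector_fields A"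
  shows "g p (curvature D X Y Z p) (W p) =
    X p (\<lambda>q. g q (D q (Y q) Z) (W q)) - g p (D p (Y p) Z) (D p (X p) W)
    - (Y p (\<lambda>q. g q (D q (X q) Z) (W q)) - g p (D p (X p) Z) (D p (Y p) W))
    - g p (D p (lie_bracket X Y p) Z) (W p)"
  using assms D_metric[of "X p" p "\<lambda>q. D q (Y q) Z" W] D_metric[of "Y p" p "\<lambda>q. D q (X q) Z" W]
  unfolding curvature_def by (simp add: tangentI g_diff_left)

text \<open>Applies the bracket as a commutator of derivations to the function
  \<open>g(Z, W)\<close> and expands both sides by metric compatibility.\<close>

lemma curvature_skew_right:
  assumes X: "X \<in> vector_fields A" and Y: "Y \<in> vector_fields A"
    and Z: "Z \<in> vector_fields A" and W: "W \<in> vector_fields A"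
  shows "g p (curvature D X Y Z p) (W p) = - g p (curvature D X Y W p) (Z p)"
proof -
  have 1: "U p (\<lambda>q. V q (\<lambda>r. g r (Z r) (W r))) =
      U p (\<lambda>q. g q (D q (V q) Z) (W q)) + U p (\<lambda>q. g q (D q (V q) W) (Z q))"
    if "U \<in> vector_fields A" "V \<in> vector_fields A" for U V
  proof -
    have "V q (\<lambda>r. g r (Z r) (W r)) = g q (D q (V q) Z) (W q) + g q (D q (V q) W) (Z q)" for q
      using D_metric[of "V q" q Z W] g_sym[of "Z q" q "D q (V q) W"] that Z W
      by (simp add: tangentI)
    then show ?thesis
      by (simp only:) (intro tangent_add[OF vector_fields_tangent[OF that(1)]] g_smooth D_field that Z W)
  qed
  have 2: "lie_bracket X Y p (\<lambda>r. g r (Z r) (W r)) =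
      g p (D p (lie_bracket X Y p) Z) (W p) + g p (D p (lie_bracket X Y p) W) (Z p)"
    using D_metric[of "lie_bracket X Y p" p Z W] g_sym[of "Z p" p "D p (lie_bracket X Y p) W"] assms
    by (simp add: tangentI)
  show ?thesis
    using 1[OF X Y] 1[OF Y X] 2 curvature_pairing[OF X Y Z W, of p] curvature_pairing[OF X Y W Z, of p]
      g_sym[of "D p (X p) Z" p "D p (Y p) W"] g_sym[of "D p (Y p) Z" p "D p (X p) W"] assms
    by (simp add: lie_bracket_apply tangentI)
qed

text \<open>\<open>curvature_like_eq_0\<close> is applied to the curvature minus its constant
  curvature model, on the space of all vector fields with the form \<open>g p (X p) (Y p)\<close>.
  With fields as vectors, linearity over the reals suffices, and it never has to be shown that
  curvature at \<open>p\<close> depends only on values at \<open>p\<close>. \<open>U0\<close> and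
  \<open>W0\<close> supply the null pair.\<close>

lemma constant_curvature_tensor:
  assumes cc: "constant_curvature A g D c"
    and null: "U0 \<in> vector_fields A" "W0 \<in> vector_fields A" "g p (U0 p) (U0 p) = 0"
      "g p (W0 p) (W0 p) = 0" "g p (U0 p) (W0 p) = 1"
    and XYZW: "X \<in> vector_fields A" "Y \<in> vector_fields A" "Z \<in> vector_fields A" "W \<in> vector_fields A"
  shows "g p (curvature D X Y Z p) (W p) =
    c * (g p (Y p) (Z p) * g p (X p) (W p) - g p (X p) (Z p) * g p (Y p) (W p))"
proof -
  let ?b = "\<lambda>X Y. g p (X p) (Y p)"
  let ?F = "\<lambda>X Y Z W. g p (curvature D X Y Z p) (W p) - c * (?b Y Z * ?b X W - ?b X Z * ?b Y W)"
  have comb: "a *\<^sub>R X + b *\<^sub>R Y = (\<lambda>q. a *\<^sub>R X q + b *\<^sub>R Y q)" for a b and X Y :: "'m vfield"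
    by (simp add: plus_fun_def scaleR_fun_def)
  note tI = vector_fields_tangent curvature_tangent
  have "?F X Y Z W = 0"
  proof (rule curvature_like_eq_0[where V = "vector_fields A" and b = ?b and F = ?F and ?u0.0 = U0 and ?w0.0 = W0])
    fix x x' y z w s t
    assume x: "x \<in> vector_fields A" and x': "x' \<in> vector_fields A" and y: "y \<in> vector_fields A"
      and z: "z \<in> vector_fields A" and w: "w \<in> vector_fields A"
    then show "?F (s *\<^sub>R x + t *\<^sub>R x') y z w = s * ?F x y z w + t * ?F x' y z w"
      unfolding comb
      by (simp add: curvature_linear_comb g_linear_comb_left tI algebra_simps)
  next
    fix x y z w
    assume *: "x \<in> vector_fields A" "y \<in> vector_fields A" "z \<in> vector_fields A" "w \<in> vector_fields A"
    show "?F x y z w = - ?F y x z w"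
      using * g_uminus_left[of "curvature D y x z p" p "w p"] curvature_skew[of x y z p]
      by (simp add: tI algebra_simps)
    show "?F x y z w = - ?F x y w z"
      using curvature_skew_right[OF *, of p] by (simp add: algebra_simps)
    have "g p (curvature D x y z p) (w p) + g p (curvature D y z x p) (w p)
        + g p (curvature D z x y p) (w p) = g p 0 (w p)"
      using * by (simp add: tI tangent_space_closed flip: g_add_left curvature_bianchi[of x y z p])
    then show "?F x y z w + ?F y z x w + ?F z x y w = 0"
      using * g_zero_left[of "w p" p] g_sym[of "x p" p "y p"] g_sym[of "x p" p "z p"]
        g_sym[of "y p" p "z p"]
      by (simp add: tI algebra_simps)
  next
    fix x y
    assume *: "x \<in> vector_fields A" "y \<in> vector_fields A" "?b x x * ?b y y - (?b x y)\<^sup>2 \<noteq> 0"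
    then have "g p (curvature D x y y p) (x p) = c * (?b x x * ?b y y - (?b x y)\<^sup>2)"
      using cc by (auto simp: constant_curvature_def sectional_curvature_def gram2_def field_simps)
    then show "?F x y y x = 0"
      using * g_sym[of "x p" p "y p"] by (simp add: tI power2_eq_square algebra_simps)
  qed (use null XYZW subspace_vector_fields in \<open>auto simp: comb g_linear_comb_left tI g_sym\<close>)
  then show ?thesis by simp
qed

end

section \<open>Eigenframes on null hypersurfaces\<close>

lemma tangent_sub_tangent: "v \<in> tangent_sub A M p \<Longrightarrow> v \<in> tangent_space A p"
  by (simp add: tangent_sub_def)

lemma agree_near_iff_inter:
  "open U \<Longrightarrow> q \<in> U \<Longrightarrow> (\<forall>r\<in>M \<inter> U. f r = h r) \<Longrightarrow> agree_near M q f h"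
  by (auto simp: agree_near_def)

text \<open>The difference of \<open>f\<close> and \<open>h\<close> vanishes on \<open>M\<close>
  near \<open>q\<close>, hence is annihilated by vectors tangent to \<open>M\<close>. This is what
  makes derivatives of extensions independent of the extension.\<close>

lemma tangent_sub_cong:
  assumes "v \<in> tangent_sub A M q" "f \<in> smooth_functions A" "h \<in> smooth_functions A" "agree_near M q f h"
  shows "v f = v h"
proof -
  have "agree_near M q (\<lambda>r. f r - h r) (\<lambda>r. 0)"
    using assms(4) by (auto simp: agree_near_def)
  then have "v (\<lambda>r. f r - h r) = 0"
    using assms smooth_functions_diff[OF assms(2,3)] by (auto simp: tangent_sub_def)
  then show ?thesis using tangent_diff[OF tangent_sub_tangent[OF assms(1)] assms(2,3)] by simp
qed

text \<open>If \<open>f\<close> vanishes on \<open>M\<close> near \<open>q\<close>, so do its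
  derivatives along \<open>X\<close> and \<open>Y\<close>, as these are tangent to \<open>M\<close>;
  hence both iterated derivatives are zero at \<open>q\<close>.\<close>

lemma lie_bracket_tangent_sub:
  assumes "X \<in> vector_fields A" "Y \<in> vector_fields A" "lie_bracket X Y q \<in> tangent_space A q"
    and U: "open U" "q \<in> M \<inter> U"
    and T: "\<And>r. r \<in> M \<inter> U \<Longrightarrow> X r \<in> tangent_sub A M r" "\<And>r. r \<in> M \<inter> U \<Longrightarrow> Y r \<in> tangent_sub A M r"
  shows "lie_bracket X Y q \<in> tangent_sub A M q"
proof -
  have "lie_bracket X Y q f = 0" if f: "f \<in> smooth_functions A" and near0: "agree_near M q f (\<lambda>r. 0)" for f
  proof -
    obtain U' where U': "open U'" "q \<in> U'" "\<forall>r\<in>M \<inter> U'. f r = 0"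
      using near0 by (auto simp: agree_near_def)
    have *: "Z r f = 0" if "r \<in> M \<inter> (U \<inter> U')" "Z r \<in> tangent_sub A M r" for Z r
      using that f U' by (auto simp: tangent_sub_def agree_near_def)
    have near: "agree_near M q (\<lambda>r. Z r f) (\<lambda>r. 0)"
      if "\<And>r. r \<in> M \<inter> U \<Longrightarrow> Z r \<in> tangent_sub A M r" for Z
      by (rule agree_near_iff_inter[of "U \<inter> U'"]) (use U U' that * in \<open>auto\<close>)
    have "X q (\<lambda>r. Y r f) = 0"
      using T(1)[OF U(2)] near[OF T(2)] vector_fields_smooth[OF assms(2) f] by (simp add: tangent_sub_def)
    moreover have "Y q (\<lambda>r. X r f) = 0"
      using T(2)[OF U(2)] near[OF T(1)] vector_fields_smooth[OF assms(1) f] by (simp add: tangent_sub_def)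
    ultimately show ?thesis by (simp add: lie_bracket_apply)
  qed
  then show ?thesis using assms(3) by (simp add: tangent_sub_def)
qed

section \<open>Dual families and null frames\<close>

lemma (in lorentz_space) dual_family_coord:
  assumes "finite J" and uT: "\<And>k. k \<in> J \<Longrightarrow> u k \<in> tangent_space A q"
    and dT: "\<And>k. k \<in> J \<Longrightarrow> d k \<in> tangent_space A q"
    and dual: "\<And>i j. i \<in> J \<Longrightarrow> j \<in> J \<Longrightarrow> g q (u i) (d j) = (if i = j then 1 else 0)"
    and j: "j \<in> J"
  shows "g q (\<Sum>k\<in>J. r k *\<^sub>R u k) (d j) = r j"
proof -
  have "g q (\<Sum>k\<in>J. r k *\<^sub>R u k) (d j) = (\<Sum>k\<in>J. g q (r k *\<^sub>R u k) (d j))"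
    by (intro g_sum_left tangent_space_closed uT dT j)
  also have "\<dots> = (\<Sum>k\<in>J. r k * g q (u k) (d j))"
    by (intro sum.cong refl g_scale_left uT dT j)
  also have "\<dots> = (\<Sum>k\<in>J. if k = j then r k else 0)"
    using j by (intro sum.cong) (auto simp: dual)
  finally show ?thesis using j assms(1) by simp
qed

lemma (in lorentz_space) dual_family_inj:
  assumes "finite J" and uT: "\<And>k. k \<in> J \<Longrightarrow> u k \<in> tangent_space A q"
    and dT: "\<And>k. k \<in> J \<Longrightarrow> d k \<in> tangent_space A q"
    and dual: "\<And>i j. i \<in> J \<Longrightarrow> j \<in> J \<Longrightarrow> g q (u i) (d j) = (if i = j then 1 else 0)"
  shows "inj_on u J"
proof (rule inj_onI)
  fix i j assume "i \<in> J" "j \<in> J" "u i = u j"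
  with dual[of i j] dual[of j j] show "i = j" by (auto split: if_splits)
qed

text \<open>Pairing a vanishing combination with \<open>d j\<close> isolates the coefficient of
  \<open>u j\<close>. Two families appear because a null vector is paired with a different
  vector.\<close>

lemma (in lorentz_space) dual_family_independent:
  assumes "finite J" and uT: "\<And>k. k \<in> J \<Longrightarrow> u k \<in> tangent_space A q"
    and dT: "\<And>k. k \<in> J \<Longrightarrow> d k \<in> tangent_space A q"
    and dual: "\<And>i j. i \<in> J \<Longrightarrow> j \<in> J \<Longrightarrow> g q (u i) (d j) = (if i = j then 1 else 0)"
  shows "independent (u ` J)"
proof -
  have inj: "inj_on u J"
    by (rule dual_family_inj) (fact assms)+
  have coord: "g q (\<Sum>k\<in>J. r k *\<^sub>R u k) (d j) = r j" if "j \<in> J" for r j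
    by (rule dual_family_coord) (fact assms that)+
  have zero: "r x = 0" if 0: "(\<Sum>x\<in>u ` J. r x *\<^sub>R x) = 0" and x: "x \<in> u ` J" for r x
  proof -
    from x obtain j where j: "j \<in> J" "x = u j" by blast
    have S: "(\<Sum>k\<in>J. r (u k) *\<^sub>R u k) = 0"
      using 0 by (simp only: sum.reindex[OF inj] o_def)
    have "r (u j) = g q (\<Sum>k\<in>J. r (u k) *\<^sub>R u k) (d j)"
      using coord[OF j(1), of "\<lambda>k. r (u k)"] by (rule sym)
    also have "\<dots> = 0"
      by (simp only: S g_zero_left[OF dT[OF j(1)]])
    finally show ?thesis by (simp only: j(2))
  qed
  have fin: "finite (u ` J)" by (intro finite_imageI assms)
  show ?thesis
    unfolding dependent_finite[OF fin] using zero by blast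
qed

text \<open>\<open>E\<close>, \<xi> and \<open>N\<close> are global ambient fields, so that
  \<open>D\<close> and \<open>curvature\<close> apply to them; tangency and the frame relations hold
  only on \<open>M \<inter> U\<close>.\<close>

locale null_frame = lorentz_space A g D
  for A :: "('m::topological_space, 'a::euclidean_space) atlas" and g D +
  fixes n :: nat and M U :: "'m set" and E :: "nat \<Rightarrow> 'm vfield" and \<xi> N :: "'m vfield"
  assumes dim: "DIM('a) = n + 2"
    and U: "open U"
    and E_field: "j \<in> {1..n} \<Longrightarrow> E j \<in> vector_fields A"
    and \<xi>_field: "\<xi> \<in> vector_fields A"
    and N_field: "N \<in> vector_fields A"
    and E_tangent: "j \<in> {1..n} \<Longrightarrow> q \<in> M \<inter> U \<Longrightarrow> E j q \<in> tangent_sub A M q"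
    and \<xi>_tangent: "q \<in> M \<inter> U \<Longrightarrow> \<xi> q \<in> tangent_sub A M q"
    and \<xi>_perp: "q \<in> M \<inter> U \<Longrightarrow> w \<in> tangent_sub A M q \<Longrightarrow> g q (\<xi> q) w = 0"
    and EE: "\<lbrakk>i \<in> {1..n}; j \<in> {1..n}; q \<in> M \<inter> U\<rbrakk> \<Longrightarrow>
      g q (E i q) (E j q) = (if i = j then 1 else 0)"
    and NE: "\<lbrakk>j \<in> {1..n}; q \<in> M \<inter> U\<rbrakk> \<Longrightarrow> g q (N q) (E j q) = 0"
    and NN: "q \<in> M \<inter> U \<Longrightarrow> g q (N q) (N q) = 0"
    and \<xi>N: "q \<in> M \<inter> U \<Longrightarrow> g q (\<xi> q) (N q) = 1"
begin

lemmas fields = E_field \<xi>_field N_field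
lemmas frame_tangent = fields[THEN vector_fields_tangent]

lemma \<xi>E: "j \<in> {1..n} \<Longrightarrow> q \<in> M \<inter> U \<Longrightarrow> g q (\<xi> q) (E j q) = 0"
  by (intro \<xi>_perp E_tangent)

lemma \<xi>\<xi>: "q \<in> M \<inter> U \<Longrightarrow> g q (\<xi> q) (\<xi> q) = 0"
  by (intro \<xi>_perp \<xi>_tangent)

lemma frame_products:
  assumes "q \<in> M \<inter> U"
  shows "g q (N q) (\<xi> q) = 1"
    and "j \<in> {1..n} \<Longrightarrow> g q (E j q) (\<xi> q) = 0"
    and "j \<in> {1..n} \<Longrightarrow> g q (E j q) (N q) = 0"
  using \<xi>N[OF assms] \<xi>E[OF _ assms] NE[OF _ assms] g_sym frame_tangent by metis+

lemmas frame_metric = EE NE NN \<xi>N \<xi>E \<xi>\<xi> frame_products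

lemma frame_expansion:
  assumes q: "q \<in> M \<inter> U" and w: "w \<in> tangent_space A q"
  shows "w = (\<Sum>k=1..n. g q w (E k q) *\<^sub>R E k q) + g q w (N q) *\<^sub>R \<xi> q + g q w (\<xi> q) *\<^sub>R N q"
proof -
  \<comment> \<open>Indices 0 and \<open>Suc n\<close> stand for \<xi> and \<open>N\<close>. The
    dual family \<open>d\<close> swaps the two, since each has product 1 with the other.\<close>
  define u where "u k = (if k = 0 then \<xi> q else if k = Suc n then N q else E k q)" for k
  define d where "d k = (if k = 0 then N q else if k = Suc n then \<xi> q else E k q)" for k
  let ?J = "{0..Suc n}"
  have uT: "u k \<in> tangent_space A q" and dT: "d k \<in> tangent_space A q" if "k \<in> ?J" for k
    using that by (auto simp: u_def d_def frame_tangent)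
  have dual: "g q (u i) (d j) = (if i = j then 1 else 0)" if "i \<in> ?J" "j \<in> ?J" for i j
    using that q by (auto simp: u_def d_def frame_metric)
  have inj: "inj_on u ?J"
    by (rule dual_family_inj[OF finite_atLeastAtMost]) (fact uT dT dual)+
  have ind: "independent (u ` ?J)"
    by (rule dual_family_independent[OF finite_atLeastAtMost]) (fact uT dT dual)+
  have coord: "g q (\<Sum>k\<in>?J. r k *\<^sub>R u k) (d j) = r j" if "j \<in> ?J" for r j
    by (rule dual_family_coord[OF finite_atLeastAtMost]) (fact uT dT dual that)+
  have fin: "finite (u ` ?J)" by (intro finite_imageI finite_atLeastAtMost)
  have cardB: "card (u ` ?J) = n + 2"
    by (simp only: card_image[OF inj] card_atLeastAtMost)
  have BT: "u ` ?J \<subseteq> tangent_space A q"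
    by (rule image_subsetI) (rule uT)
  \<comment> \<open>Otherwise \<open>w\<close> and the frame would be n + 3 independent vectors in a
    space spanned by the n + 2 vectors of a Lorentzian basis.\<close>
  have "w \<in> span (u ` ?J)"
  proof (rule ccontr)
    assume w': "w \<notin> span (u ` ?J)"
    have ind': "independent (insert w (u ` ?J))"
      by (rule independent_insertI[OF w' ind])
    have notin: "w \<notin> u ` ?J" by (rule contrapos_nn[OF w' span_base])
    obtain e where e: "span (e ` {..<DIM('a)}) = tangent_space A q"
      using lorentz[unfolded lorentzian_metric_def, THEN conjunct2, THEN conjunct2, rule_format, of q] by blast
    have "insert w (u ` ?J) \<subseteq> span (e ` {..<DIM('a)})"
      unfolding e by (rule insert_subsetI[OF w BT])
    then have "card (insert w (u ` ?J)) \<le> card (e ` {..<DIM('a)})"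
      by (rule independent_span_bound[OF _ ind', THEN conjunct2, rotated]) (intro finite_imageI finite_lessThan)
    also have "\<dots> \<le> n + 2"
      using card_image_le[of "{..<DIM('a)}" e] dim by simp
    finally show False
      by (simp only: card_insert_disjoint[OF fin notin] cardB)
  qed
  then obtain r0 where "w = (\<Sum>x\<in>u ` ?J. r0 x *\<^sub>R x)"
    unfolding span_finite[OF fin] by blast
  then have w_eq: "w = (\<Sum>k\<in>?J. r0 (u k) *\<^sub>R u k)"
    by (simp only: sum.reindex[OF inj] o_def)
  have r0: "r0 (u j) = g q w (d j)" if "j \<in> ?J" for j
    using coord[OF that, of "\<lambda>k. r0 (u k)", folded w_eq] by (rule sym)
  note w_eq
  also have "(\<Sum>k\<in>?J. r0 (u k) *\<^sub>R u k) = (\<Sum>k\<in>?J. g q w (d k) *\<^sub>R u k)"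
    by (intro sum.cong refl) (simp only: r0)
  also have "?J = insert 0 (insert (Suc n) {1..n})" by auto
  also have "(\<Sum>k\<in>insert 0 (insert (Suc n) {1..n}). g q w (d k) *\<^sub>R u k) =
      g q w (N q) *\<^sub>R \<xi> q + (g q w (\<xi> q) *\<^sub>R N q + (\<Sum>k=1..n. g q w (d k) *\<^sub>R u k))"
    by (simp add: u_def d_def)
  also have "(\<Sum>k=1..n. g q w (d k) *\<^sub>R u k) = (\<Sum>k=1..n. g q w (E k q) *\<^sub>R E k q)"
    by (rule sum.cong) (auto simp: u_def d_def)
  finally show ?thesis by (simp only: ac_simps)
qed

lemma g_expansion:
  assumes q: "q \<in> M \<inter> U" and v: "v \<in> tangent_space A q" and w: "w \<in> tangent_space A q"
  shows "g q v w = (\<Sum>k=1..n. g q v (E k q) * g q w (E k q))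
    + g q v (N q) * g q w (\<xi> q) + g q v (\<xi> q) * g q w (N q)"
proof -
  have "g q v w = g q ((\<Sum>k=1..n. g q v (E k q) *\<^sub>R E k q) + g q v (N q) *\<^sub>R \<xi> q + g q v (\<xi> q) *\<^sub>R N q) w"
    using frame_expansion[OF q v] by simp
  also have "\<dots> = (\<Sum>k=1..n. g q v (E k q) * g q (E k q) w)
    + g q v (N q) * g q (\<xi> q) w + g q v (\<xi> q) * g q (N q) w"
  proof -
    have "g q (\<Sum>k=1..n. g q v (E k q) *\<^sub>R E k q) w = (\<Sum>k=1..n. g q v (E k q) * g q (E k q) w)"
    proof (rule trans)
      show "g q (\<Sum>k=1..n. g q v (E k q) *\<^sub>R E k q) w = (\<Sum>k=1..n. g q (g q v (E k q) *\<^sub>R E k q) w)"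
        by (intro g_sum_left tangent_space_closed frame_tangent w)
      show "(\<Sum>k=1..n. g q (g q v (E k q) *\<^sub>R E k q) w) = (\<Sum>k=1..n. g q v (E k q) * g q (E k q) w)"
        by (intro sum.cong refl g_scale_left frame_tangent w)
    qed
    moreover have "(\<Sum>k=1..n. g q v (E k q) *\<^sub>R E k q) \<in> tangent_space A q"
      by (intro tangent_space_closed frame_tangent)
    ultimately show ?thesis
      using w by (simp add: g_add_left frame_tangent tangent_space_closed g_scale_left)
  qed
  finally show ?thesis
    using w by (simp add: g_sym[OF w] frame_tangent)
qed

lemma g_nondegenerate:
  assumes q: "q \<in> M \<inter> U" and w: "w \<in> tangent_space A q"
    and "\<And>Z. Z \<in> vector_fields A \<Longrightarrow> g q w (Z q) = 0"
  shows "w = 0"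
  using frame_expansion[OF q w] assms(3)[OF E_field] assms(3)[OF \<xi>_field] assms(3)[OF N_field]
  by simp

text \<open>By metric compatibility the products of \<open>D q v X\<close> with fields are
  determined by derivatives along \<open>v\<close> of products, and a tangent \<open>v\<close> sees
  these only on \<open>M\<close>. Nondegeneracy concludes.\<close>

lemma D_cong:
  assumes q: "q \<in> M \<inter> U" and v: "v \<in> tangent_sub A M q"
    and X: "X \<in> vector_fields A" and Y: "Y \<in> vector_fields A" and XY: "agree_near M q X Y"
  shows "D q v X = D q v Y"
proof -
  note v' = tangent_sub_tangent[OF v]
  have XYq: "X q = Y q" using XY q by (auto simp: agree_near_def)
  have "g q (D q v X - D q v Y) (Z q) = 0" if Z: "Z \<in> vector_fields A" for Z
  proof -
    have "v (\<lambda>r. g r (X r) (Z r)) = v (\<lambda>r. g r (Y r) (Z r))"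
      by (rule tangent_sub_cong[OF v g_smooth[OF X Z] g_smooth[OF Y Z]])
        (use XY in \<open>auto simp: agree_near_def\<close>)
    then show ?thesis
      using D_metric[OF v' X Z] D_metric[OF v' Y Z] XYq X Y Z v'
      by (simp add: g_diff_left D_tangent vector_fields_tangent)
  qed
  then have "D q v X - D q v Y = 0"
    by (intro g_nondegenerate[OF q] tangent_space_closed D_tangent v' X Y)
  then show ?thesis by simp
qed

text \<open>Two admissible extensions agree on \<open>M\<close> near \<open>q\<close>, so
  \<open>D_cong\<close> makes the \<open>THE\<close> in \<open>cov_along\<close> well
  defined.\<close>

lemma cov_along_eq:
  assumes q: "q \<in> M \<inter> U" and v: "v \<in> tangent_sub A M q"
    and Y: "Y \<in> vector_fields A" and XY: "agree_near M q Y X"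
  shows "cov_along A D M q v X = D q v Y"
  unfolding cov_along_def
proof (rule the_equality)
  fix w assume "\<exists>Y\<in>vector_fields A. agree_near M q Y X \<and> w = D q v Y"
  then obtain Z where Z: "Z \<in> vector_fields A" "agree_near M q Z X" "w = D q v Z" by auto
  have "agree_near M q Z Y"
  proof -
    obtain O1 O2 where "open O1" "q \<in> O1" "\<forall>r\<in>M \<inter> O1. Y r = X r"
      "open O2" "q \<in> O2" "\<forall>r\<in>M \<inter> O2. Z r = X r"
      using XY Z(2) unfolding agree_near_def by blast
    then show ?thesis unfolding agree_near_def by (intro exI[of _ "O1 \<inter> O2"]) auto
  qed
  then show "w = D q v Y" using D_cong[OF q v Z(1) Y] Z(3) by simp
qed (use assms in auto)

text \<open>Metric compatibility for a product that is constant on \<open>M\<close>; the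
  skew-symmetries of the connection coefficients in \<open>D_frame\<close> all come from
  here.\<close>

lemma pairing_const:
  assumes Y: "Y \<in> vector_fields A" and Z: "Z \<in> vector_fields A"
    and a: "\<And>r. r \<in> M \<inter> U \<Longrightarrow> g r (Y r) (Z r) = a"
    and q: "q \<in> M \<inter> U" and v: "v \<in> tangent_sub A M q"
  shows "g q (D q v Y) (Z q) = - g q (D q v Z) (Y q)"
proof -
  note v' = tangent_sub_tangent[OF v]
  have "v (\<lambda>r. g r (Y r) (Z r)) = v (\<lambda>r. a)"
    by (rule tangent_sub_cong[OF v g_smooth[OF Y Z] smooth_functions_const])
      (rule agree_near_iff_inter[OF U], use q a in auto)
  then show ?thesis
    using D_metric[OF v' Y Z] tangent_const[OF v', of a] Y Z v'
    by (simp add: g_sym[of "Y q"] D_tangent vector_fields_tangent)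
qed

lemma D_\<xi>_\<xi>:
  assumes "q \<in> M \<inter> U" "v \<in> tangent_sub A M q"
  shows "g q (D q v \<xi>) (\<xi> q) = 0"
  using pairing_const[OF \<xi>_field \<xi>_field \<xi>\<xi> assms] by simp

lemma D_frame:
  assumes q: "q \<in> M \<inter> U" and v: "v \<in> tangent_sub A M q" and i: "i \<in> {1..n}"
  shows D_E_E: "j \<in> {1..n} \<Longrightarrow> g q (D q v (E i)) (E j q) = - g q (D q v (E j)) (E i q)"
    and D_E_\<xi>: "g q (D q v (E i)) (\<xi> q) = - g q (D q v \<xi>) (E i q)"
    and D_E_N: "g q (D q v (E i)) (N q) = - g q (D q v N) (E i q)"
proof -
  show "g q (D q v (E i)) (E j q) = - g q (D q v (E j)) (E i q)" if j: "j \<in> {1..n}"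
    by (rule pairing_const[OF E_field[OF i] E_field[OF j] EE[OF i j] q v])
  show "g q (D q v (E i)) (\<xi> q) = - g q (D q v \<xi>) (E i q)"
    by (rule pairing_const[OF E_field[OF i] \<xi>_field frame_products(2)[OF _ i] q v])
  show "g q (D q v (E i)) (N q) = - g q (D q v N) (E i q)"
    by (rule pairing_const[OF E_field[OF i] N_field frame_products(3)[OF _ i] q v])
qed

text \<open>Here \<xi>' and \<open>N'\<close> are sections given on \<open>M\<close>, and \<xi> is
  an ambient extension. Once \<tau> is zero, the only correction left is the
  \<open>N\<close>-coefficient of the derivative of \<xi>, and \<open>D_\<xi>_\<xi>\<close> makes it
  zero.\<close>

lemma shape_\<xi>_eq:
  assumes q: "q \<in> M \<inter> U" and v: "v \<in> tangent_sub A M q" and \<xi>': "agree_near M q \<xi> \<xi>'" "\<xi>' q = \<xi> q"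
    and \<tau>: "null_tau A g D M \<xi>' N' q v = 0"
  shows "shape_\<xi> A g D M \<xi>' N' q v = - D q v \<xi>"
  using \<xi>'(2) \<tau> D_\<xi>_\<xi>[OF q v]
  by (simp add: shape_\<xi>_def induced_connection_def null_sff_def cov_along_eq[OF q v \<xi>_field \<xi>'(1)])

lemma shape_N_eq:
  assumes q: "q \<in> M \<inter> U" and v: "v \<in> tangent_sub A M q" and N': "agree_near M q N N'"
    and \<tau>: "null_tau A g D M \<xi>' N' q v = 0"
  shows "shape_N A g D M \<xi>' N' q v = - D q v N"
  using \<tau> by (simp add: shape_N_def cov_along_eq[OF q v N_field N'])

end

text \<open>\<open>D_\<xi>\<close> is the Weingarten formula for \<xi> with \<tau> zero on the
  screen. The \<kappa> are constant in screen directions only and may vary along \<xi>.\<close>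

locale null_eigenframe = null_frame A g D n M U E \<xi> N
  for A :: "('m::topological_space, 'a::euclidean_space) atlas" and g D n M U E \<xi> N +
  fixes c :: real and \<kappa> :: "nat \<Rightarrow> 'm \<Rightarrow> real"
  assumes cc: "constant_curvature A g D c"
    and \<kappa>_smooth: "j \<in> {1..n} \<Longrightarrow> \<kappa> j \<in> smooth_functions A"
    and D_\<xi>: "j \<in> {1..n} \<Longrightarrow> q \<in> M \<inter> U \<Longrightarrow> D q (E j q) \<xi> = - \<kappa> j q *\<^sub>R E j q"
    and \<kappa>_const: "i \<in> {1..n} \<Longrightarrow> j \<in> {1..n} \<Longrightarrow> q \<in> M \<inter> U \<Longrightarrow> E i q (\<kappa> j) = 0"
begin

definition \<Gamma> :: "'m \<Rightarrow> nat \<Rightarrow> nat \<Rightarrow> nat \<Rightarrow> real" where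
  "\<Gamma> q i j k = g q (D q (E i q) (E j)) (E k q)"

text \<open>The coefficient of \<xi> in the derivative of \<open>E j\<close>. By
  \<open>D_E_N\<close> it equals \<open>g(A\<^sub>N E\<^sub>i, E\<^sub>j)\<close>, the screen second
  fundamental form.\<close>

definition C :: "'m \<Rightarrow> nat \<Rightarrow> nat \<Rightarrow> real" where
  "C q i j = g q (D q (E i q) (E j)) (N q)"

lemma deriv_cong:
  assumes "q \<in> M \<inter> U" "v \<in> tangent_sub A M q" "f \<in> smooth_functions A" "h \<in> smooth_functions A"
    and "\<And>r. r \<in> M \<inter> U \<Longrightarrow> f r = h r"
  shows "v f = v h"
  using assms by (intro tangent_sub_cong[OF assms(2-4)] agree_near_iff_inter[OF U]) auto

lemma deriv_const:
  assumes "q \<in> M \<inter> U" "v \<in> tangent_sub A M q" "f \<in> smooth_functions A"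
    and "\<And>r. r \<in> M \<inter> U \<Longrightarrow> f r = a"
  shows "v f = 0"
  using deriv_cong[OF assms(1-3) smooth_functions_const[of a] assms(4)]
    tangent_const[OF tangent_sub_tangent[OF assms(2)]] by simp

section \<open>Relations between the connection coefficients\<close>

lemma \<Gamma>_skew:
  assumes "q \<in> M \<inter> U" "i \<in> {1..n}" "j \<in> {1..n}" "k \<in> {1..n}"
  shows "\<Gamma> q i j k = - \<Gamma> q i k j"
  unfolding \<Gamma>_def using assms by (intro D_frame E_tangent)

lemma g_D_\<xi>:
  assumes q: "q \<in> M \<inter> U" and j: "j \<in> {1..n}" and w: "w \<in> tangent_space A q"
  shows "g q (D q (E j q) \<xi>) w = - \<kappa> j q * g q (E j q) w"
  by (simp only: D_\<xi>[OF j q] g_scale_left[OF frame_tangent(1)[OF j] w])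

lemma D_E_\<xi>_value:
  assumes q: "q \<in> M \<inter> U" and i: "i \<in> {1..n}" and j: "j \<in> {1..n}"
  shows "g q (D q (E i q) (E j)) (\<xi> q) = (if i = j then \<kappa> i q else 0)"
  using D_E_\<xi>[OF q E_tangent[OF i q] j] g_D_\<xi>[OF q i frame_tangent(1)[OF j]] EE[OF i j q]
  by simp

lemma D_in: "v \<in> tangent_sub A M q \<Longrightarrow> Y \<in> vector_fields A \<Longrightarrow> D q v Y \<in> tangent_space A q"
  by (intro D_tangent tangent_sub_tangent)

lemma bracket_tangent:
  assumes q: "q \<in> M \<inter> U" and XY: "X \<in> vector_fields A" "Y \<in> vector_fields A"
    and T: "\<And>r. r \<in> M \<inter> U \<Longrightarrow> X r \<in> tangent_sub A M r" "\<And>r. r \<in> M \<inter> U \<Longrightarrow> Y r \<in> tangent_sub A M r"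
  shows "lie_bracket X Y q \<in> tangent_sub A M q"
  by (rule lie_bracket_tangent_sub[OF XY vector_fields_tangent[OF lie_bracket_field[OF XY]] U q T])

text \<open>The bracket of \<xi> and \<open>E j\<close> is tangent to \<open>M\<close>, hence
  orthogonal to \<xi>, and by torsion-freeness the other derivative in it is already known to be
  orthogonal to \<xi>.\<close>

lemma D_\<xi>_E_\<xi>:
  assumes q: "q \<in> M \<inter> U" and j: "j \<in> {1..n}"
  shows "g q (D q (\<xi> q) (E j)) (\<xi> q) = 0"
proof -
  have "g q (lie_bracket \<xi> (E j) q) (\<xi> q) = 0"
    using \<xi>_perp[OF q bracket_tangent[OF q \<xi>_field E_field[OF j] \<xi>_tangent E_tangent[OF j]]]
      g_sym[OF frame_tangent(2) vector_fields_tangent[OF lie_bracket_field[OF \<xi>_field E_field[OF j]]], of q]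
    by simp
  then show ?thesis
    using D_\<xi>_\<xi>[OF q E_tangent[OF j q]] \<xi>_field E_field[OF j]
    by (simp add: torsion_free g_diff_left D_tangent vector_fields_tangent)
qed

text \<open>Together with \<open>D_\<xi>_\<xi>\<close> this leaves only a \<xi>-component, so
  integral curves of \<xi> are geodesics up to parametrization. It removes the \<xi>-part of
  brackets from the Codazzi equations.\<close>

lemma \<xi>_geodesic:
  assumes q: "q \<in> M \<inter> U" and j: "j \<in> {1..n}"
  shows "g q (D q (\<xi> q) \<xi>) (E j q) = 0"
  using D_E_\<xi>[OF q \<xi>_tangent[OF q] j] D_\<xi>_E_\<xi>[OF q j] by simp

text \<open>A tangent \<open>v\<close> is orthogonal to \<xi> and so has no
  \<open>N\<close>-component; only the directions \<open>E k\<close> and \<xi> occur.\<close>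

lemma g_D_expansion:
  assumes q: "q \<in> M \<inter> U" and v: "v \<in> tangent_sub A M q" and Y: "Y \<in> vector_fields A"
    and w: "w \<in> tangent_space A q"
  shows "g q (D q v Y) w =
    (\<Sum>k=1..n. g q v (E k q) * g q (D q (E k q) Y) w) + g q v (N q) * g q (D q (\<xi> q) Y) w"
proof -
  note v' = tangent_sub_tangent[OF v]
  have v\<xi>: "g q v (\<xi> q) = 0"
    using \<xi>_perp[OF q v] g_sym[OF v' frame_tangent(2)] by simp
  let ?s = "\<Sum>k=1..n. g q v (E k q) *\<^sub>R E k q"
  have s: "?s \<in> tangent_space A q" by (intro tangent_space_closed frame_tangent)
  have "v = ?s + g q v (N q) *\<^sub>R \<xi> q"
    using frame_expansion[OF q v'] by (simp only: v\<xi> scaleR_zero_left add_0_right)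
  then have "D q v Y = D q (?s + g q v (N q) *\<^sub>R \<xi> q) Y"
    by (rule arg_cong)
  also have "\<dots> = D q ?s Y + g q v (N q) *\<^sub>R D q (\<xi> q) Y"
    using s Y by (simp add: D_add_dir D_scale_dir frame_tangent tangent_space_closed)
  also have "D q ?s Y = (\<Sum>k=1..n. D q (g q v (E k q) *\<^sub>R E k q) Y)"
    by (intro D_sum_dir tangent_space_closed frame_tangent Y)
  also have "\<dots> = (\<Sum>k=1..n. g q v (E k q) *\<^sub>R D q (E k q) Y)"
    by (intro sum.cong refl D_scale_dir frame_tangent Y)
  finally have 1: "D q v Y = (\<Sum>k=1..n. g q v (E k q) *\<^sub>R D q (E k q) Y) + g q v (N q) *\<^sub>R D q (\<xi> q) Y" .
  have "g q (D q v Y) w = g q (\<Sum>k=1..n. g q v (E k q) *\<^sub>R D q (E k q) Y) w + g q (g q v (N q) *\<^sub>R D q (\<xi> q) Y) w"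
    unfolding 1 by (intro g_add_left tangent_space_closed D_tangent frame_tangent Y w)
  also have "g q (g q v (N q) *\<^sub>R D q (\<xi> q) Y) w = g q v (N q) * g q (D q (\<xi> q) Y) w"
    by (intro g_scale_left D_tangent frame_tangent Y w)
  also have "g q (\<Sum>k=1..n. g q v (E k q) *\<^sub>R D q (E k q) Y) w =
      (\<Sum>k=1..n. g q (g q v (E k q) *\<^sub>R D q (E k q) Y) w)"
    by (intro g_sum_left tangent_space_closed D_tangent frame_tangent Y w)
  also have "\<dots> = (\<Sum>k=1..n. g q v (E k q) * g q (D q (E k q) Y) w)"
    by (intro sum.cong refl g_scale_left D_tangent frame_tangent Y w)
  finally show ?thesis .
qed

section \<open>Codazzi equations\<close>

lemma curvature_value:
  assumes "q \<in> M \<inter> U"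
    and "X \<in> vector_fields A" "Y \<in> vector_fields A" "Z \<in> vector_fields A" "W \<in> vector_fields A"
  shows "g q (curvature D X Y Z q) (W q) =
    c * (g q (Y q) (Z q) * g q (X q) (W q) - g q (X q) (Z q) * g q (Y q) (W q))"
  by (rule constant_curvature_tensor[OF cc \<xi>_field N_field \<xi>\<xi> NN \<xi>N]) (use assms in auto)

lemma g_bracket:
  assumes "X \<in> vector_fields A" "Y \<in> vector_fields A" "w \<in> tangent_space A q"
  shows "g q (lie_bracket X Y q) w = g q (D q (X q) Y) w - g q (D q (Y q) X) w"
  using assms by (simp add: torsion_free g_diff_left D_tangent vector_fields_tangent)

text \<open>On \<open>M \<inter> U\<close> the function is \<open>- \<kappa> j\<close> or zero. The
  condition on \<open>\<kappa> j\<close> is confined to the diagonal so that the off-diagonal case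
  also serves the direction \<xi>.\<close>

lemma deriv_D_\<xi>:
  assumes q: "q \<in> M \<inter> U" and j: "j \<in> {1..n}" and k: "k \<in> {1..n}" and v: "v \<in> tangent_sub A M q"
    and 0: "j = k \<Longrightarrow> v (\<kappa> j) = 0"
  shows "v (\<lambda>r. g r (D r (E j r) \<xi>) (E k r)) = 0"
proof (cases "j = k")
  case True
  have "v (\<lambda>r. g r (D r (E j r) \<xi>) (E k r)) = v (\<lambda>r. - \<kappa> j r)"
  proof (rule deriv_cong[OF q v])
    fix r assume "r \<in> M \<inter> U"
    then show "g r (D r (E j r) \<xi>) (E k r) = - \<kappa> j r"
      using g_D_\<xi>[OF _ j frame_tangent(1)[OF k]] EE[OF j k] True by simp
  qed (intro g_smooth D_field fields j k smooth_functions_uminus \<kappa>_smooth)+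
  then show ?thesis
    using tangent_uminus[OF tangent_sub_tangent[OF v] \<kappa>_smooth[OF j]] 0[OF True] by simp
next
  case False
  show ?thesis
  proof (rule deriv_const[OF q v])
    fix r assume "r \<in> M \<inter> U"
    then show "g r (D r (E j r) \<xi>) (E k r) = 0"
      using g_D_\<xi>[OF _ j frame_tangent(1)[OF k]] EE[OF j k] False by simp
  qed (intro g_smooth D_field fields j k)
qed

lemma sum_\<kappa>:
  assumes q: "q \<in> M \<inter> U" and k: "k \<in> {1..n}"
  shows "(\<Sum>l=1..n. a l * g q (D q (E l q) \<xi>) (E k q)) = - a k * \<kappa> k q"
proof -
  have "(\<Sum>l=1..n. a l * g q (D q (E l q) \<xi>) (E k q)) = (\<Sum>l=1..n. if l = k then - a k * \<kappa> k q else 0)"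
  proof (rule sum.cong[OF refl])
    fix l assume l: "l \<in> {1..n}"
    show "a l * g q (D q (E l q) \<xi>) (E k q) = (if l = k then - a k * \<kappa> k q else 0)"
      using g_D_\<xi>[OF q l frame_tangent(1)[OF k]] EE[OF l k q] by auto
  qed
  also have "\<dots> = - a k * \<kappa> k q" using k by simp
  finally show ?thesis .
qed

text \<open>The curvature term is zero because \<xi> is orthogonal to \<open>E i\<close> and
  \<open>E j\<close>, and the scalar derivatives vanish because the \<kappa> are constant along the
  screen. The two mixed products and the bracket term remain.\<close>

lemma codazzi:
  assumes q: "q \<in> M \<inter> U" and i: "i \<in> {1..n}" and j: "j \<in> {1..n}" and k: "k \<in> {1..n}"
  shows "(\<kappa> k q - \<kappa> j q) * \<Gamma> q i j k = (\<kappa> k q - \<kappa> i q) * \<Gamma> q j i k"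
proof -
  let ?b = "lie_bracket (E i) (E j)"
  note Ei = E_tangent[OF i q] and Ej = E_tangent[OF j q]
  have b: "?b q \<in> tangent_sub A M q"
    by (intro bracket_tangent q E_field E_tangent i j)
  have Eb: "g q (?b q) (E l q) = \<Gamma> q i j l - \<Gamma> q j i l" if "l \<in> {1..n}" for l
    unfolding \<Gamma>_def by (intro g_bracket E_field i j frame_tangent that)
  have "g q (D q (?b q) \<xi>) (E k q) = - (\<Gamma> q i j k - \<Gamma> q j i k) * \<kappa> k q"
    using g_D_expansion[OF q b \<xi>_field frame_tangent(1)[OF k]]
      sum_\<kappa>[OF q k, of "\<lambda>l. g q (?b q) (E l q)"] Eb[OF k] \<xi>_geodesic[OF q k] by simp
  moreover have "g q (D q (E j q) \<xi>) (D q (E i q) (E k)) = \<kappa> j q * \<Gamma> q i j k"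
    using g_D_\<xi>[OF q j D_in[OF Ei E_field[OF k]]] \<Gamma>_skew[OF q i j k]
      g_sym[OF frame_tangent(1)[OF j] D_in[OF Ei E_field[OF k]]] by (simp add: \<Gamma>_def)
  moreover have "g q (D q (E i q) \<xi>) (D q (E j q) (E k)) = \<kappa> i q * \<Gamma> q j i k"
    using g_D_\<xi>[OF q i D_in[OF Ej E_field[OF k]]] \<Gamma>_skew[OF q j i k]
      g_sym[OF frame_tangent(1)[OF i] D_in[OF Ej E_field[OF k]]] by (simp add: \<Gamma>_def)
  moreover have "E i q (\<lambda>r. g r (D r (E j r) \<xi>) (E k r)) = 0"
    by (rule deriv_D_\<xi>[OF q j k Ei]) (rule \<kappa>_const[OF i j q])
  moreover have "E j q (\<lambda>r. g r (D r (E i r) \<xi>) (E k r)) = 0"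
    by (rule deriv_D_\<xi>[OF q i k Ej]) (rule \<kappa>_const[OF j i q])
  ultimately show ?thesis
    using curvature_pairing[OF E_field[OF i] E_field[OF j] \<xi>_field E_field[OF k], of q]
      curvature_value[OF q E_field[OF i] E_field[OF j] \<xi>_field E_field[OF k]]
      frame_products(2)[OF q i] frame_products(2)[OF q j]
    by (simp add: algebra_simps)
qed

text \<open>For \<open>j \<noteq> k\<close> the differentiated products are zero throughout
  \<open>M \<inter> U\<close>, so the uncontrolled derivatives of the \<kappa> along \<xi> do not
  enter.\<close>

lemma codazzi_\<xi>:
  assumes q: "q \<in> M \<inter> U" and j: "j \<in> {1..n}" and k: "k \<in> {1..n}" and jk: "j \<noteq> k"
  shows "(\<kappa> k q - \<kappa> j q) * g q (D q (\<xi> q) (E j)) (E k q) = 0"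
proof -
  let ?b = "lie_bracket \<xi> (E j)"
  note Ej = E_tangent[OF j q] and X = \<xi>_tangent[OF q]
  have b: "?b q \<in> tangent_sub A M q"
    by (intro bracket_tangent q \<xi>_field E_field \<xi>_tangent E_tangent j)
  have "g q (?b q) (E k q) = g q (D q (\<xi> q) (E j)) (E k q)"
    using g_bracket[OF \<xi>_field E_field[OF j] frame_tangent(1)[OF k], of q]
      g_D_\<xi>[OF q j frame_tangent(1)[OF k]] EE[OF j k q] jk by simp
  then have "g q (D q (?b q) \<xi>) (E k q) = - g q (D q (\<xi> q) (E j)) (E k q) * \<kappa> k q"
    using g_D_expansion[OF q b \<xi>_field frame_tangent(1)[OF k]]
      sum_\<kappa>[OF q k, of "\<lambda>l. g q (?b q) (E l q)"] \<xi>_geodesic[OF q k] by simp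
  moreover have "g q (D q (E j q) \<xi>) (D q (\<xi> q) (E k)) = \<kappa> j q * g q (D q (\<xi> q) (E j)) (E k q)"
    using g_D_\<xi>[OF q j D_in[OF X E_field[OF k]]] D_E_E[OF q X j k]
      g_sym[OF frame_tangent(1)[OF j] D_in[OF X E_field[OF k]]] by simp
  moreover have "g q (D q (\<xi> q) \<xi>) (D q (E j q) (E k)) = 0"
    using g_expansion[OF q D_in[OF X \<xi>_field] D_in[OF Ej E_field[OF k]]]
      D_E_\<xi>_value[OF q j k] jk D_\<xi>_\<xi>[OF q X]
    by (simp add: \<xi>_geodesic[OF q])
  moreover have "\<xi> q (\<lambda>r. g r (D r (E j r) \<xi>) (E k r)) = 0"
    using deriv_D_\<xi>[OF q j k X] jk by blast
  moreover have "E j q (\<lambda>r. g r (D r (\<xi> r) \<xi>) (E k r)) = 0"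
    using deriv_const[OF q Ej g_smooth[OF D_field[OF \<xi>_field \<xi>_field] E_field[OF k]] \<xi>_geodesic[OF _ k]] .
  ultimately show ?thesis
    using curvature_pairing[OF \<xi>_field E_field[OF j] \<xi>_field E_field[OF k], of q]
      curvature_value[OF q \<xi>_field E_field[OF j] \<xi>_field E_field[OF k]]
      frame_products(2)[OF q j] \<xi>\<xi>[OF q]
    by (auto simp: algebra_simps)
qed

end

section \<open>Gauss equation\<close>

context null_eigenframe
begin

text \<open>Differentiating the relation at \<open>q\<close> gives no terms from the coefficients,
  which are constant along the screen, and the right coefficient is zero at \<open>q\<close>. This
  controls derivatives at points where \<open>f\<close> vanishes although it need not vanish
  nearby.\<close>

lemma deriv_zero_of_proportional:
  assumes q: "q \<in> M \<inter> U" and i: "i \<in> {1..n}"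
    and ab: "a \<in> {1..n}" "b \<in> {1..n}" and cd: "e \<in> {1..n}" "d \<in> {1..n}"
    and f: "f \<in> smooth_functions A" and h: "h \<in> smooth_functions A"
    and eq: "\<And>r. r \<in> M \<inter> U \<Longrightarrow> (\<kappa> a r - \<kappa> b r) * f r = (\<kappa> e r - \<kappa> d r) * h r"
    and "\<kappa> a q \<noteq> \<kappa> b q" "\<kappa> e q = \<kappa> d q"
  shows "E i q f = 0"
proof -
  note v = E_tangent[OF i q]
  note v' = tangent_sub_tangent[OF v]
  note s = smooth_functions_diff[OF \<kappa>_smooth[OF ab(1)] \<kappa>_smooth[OF ab(2)]]
    smooth_functions_diff[OF \<kappa>_smooth[OF cd(1)] \<kappa>_smooth[OF cd(2)]]
  have z: "E i q (\<lambda>r. \<kappa> x r - \<kappa> y r) = 0" if "x \<in> {1..n}" "y \<in> {1..n}" for x y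
    using tangent_diff[OF v' \<kappa>_smooth[OF that(1)] \<kappa>_smooth[OF that(2)]]
      \<kappa>_const[OF i that(1) q] \<kappa>_const[OF i that(2) q] by simp
  have "f q = 0" using eq[OF q] assms(10,11) by simp
  have "E i q (\<lambda>r. (\<kappa> a r - \<kappa> b r) * f r) = E i q (\<lambda>r. (\<kappa> e r - \<kappa> d r) * h r)"
    by (rule deriv_cong[OF q v smooth_functions_mult[OF s(1) f] smooth_functions_mult[OF s(2) h] eq])
  then have "(\<kappa> a q - \<kappa> b q) * E i q f = 0"
    using tangent_mult[OF v' s(1) f] tangent_mult[OF v' s(2) h] z[OF ab] z[OF cd] assms(11) by simp
  then show ?thesis using assms(10) by simp
qed

lemma \<Gamma>_smooth:
  "i \<in> {1..n} \<Longrightarrow> j \<in> {1..n} \<Longrightarrow> k \<in> {1..n} \<Longrightarrow> (\<lambda>r. \<Gamma> r i j k) \<in> smooth_functions A"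
  unfolding \<Gamma>_def by (rule g_smooth[OF D_field[OF E_field E_field] E_field])

lemma g_D_D:
  assumes q: "q \<in> M \<inter> U" and "i \<in> {1..n}" "j \<in> {1..n}" "i' \<in> {1..n}" "j' \<in> {1..n}"
  shows "g q (D q (E i q) (E j)) (D q (E i' q) (E j')) = (\<Sum>k=1..n. \<Gamma> q i j k * \<Gamma> q i' j' k)
    + C q i j * (if i' = j' then \<kappa> i' q else 0) + (if i = j then \<kappa> i q else 0) * C q i' j'"
  using g_expansion[OF q D_in[OF E_tangent E_field] D_in[OF E_tangent E_field], of i j i' j'] assms
  by (simp only: D_E_\<xi>_value \<Gamma>_def C_def)

text \<open>Up to sign, the components of the screen covariant derivative of
  \<open>A\<^sup>*\<^sub>\<xi>\<close>, as the \<kappa> are constant along the screen.\<close>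

definition Q :: "'m \<Rightarrow> nat \<Rightarrow> nat \<Rightarrow> nat \<Rightarrow> real" where
  "Q q i j k = (\<kappa> k q - \<kappa> j q) * \<Gamma> q i j k"

lemma
  assumes "q \<in> M \<inter> U" "i \<in> {1..n}" "j \<in> {1..n}" "k \<in> {1..n}"
  shows Q_sym1: "Q q i j k = Q q j i k" and Q_sym2: "Q q i j k = Q q i k j"
  using codazzi[OF assms] \<Gamma>_skew[OF assms] by (simp_all add: Q_def algebra_simps)

text \<open>The polarized form, with two indices \<open>i\<close> and \<open>i'\<close> for one
  eigenvalue, is used because the unit eigenvector in the theorem may be any combination of frame
  vectors of that eigenvalue.\<close>

lemma gauss:
  assumes q: "q \<in> M \<inter> U" and i: "i \<in> {1..n}" and i': "i' \<in> {1..n}" and j: "j \<in> {1..n}"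
    and lam: "\<kappa> i q = lam" "\<kappa> i' q = lam" "\<kappa> j q \<noteq> lam"
  shows "(if i = i' then c + lam * C q j j else 0) + \<kappa> j q * C q i i' =
    (\<Sum>k=1..n. \<Gamma> q i j k * \<Gamma> q j i' k - (\<Gamma> q i j k - \<Gamma> q j i k) * \<Gamma> q k j i')"
proof -
  have ij: "i \<noteq> j" "i' \<noteq> j" using lam by auto
  note Ei = E_tangent[OF i q] and Ej = E_tangent[OF j q]
  let ?b = "lie_bracket (E i) (E j)"
  have b: "?b q \<in> tangent_sub A M q"
    by (rule bracket_tangent[OF q E_field[OF i] E_field[OF j] E_tangent[OF i] E_tangent[OF j]])
  have Eb: "g q (?b q) (E l q) = \<Gamma> q i j l - \<Gamma> q j i l" if "l \<in> {1..n}" for l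
    unfolding \<Gamma>_def by (rule g_bracket[OF E_field[OF i] E_field[OF j] frame_tangent(1)[OF that]])
  \<comment> \<open>The bracket may have a \<xi>-component; its contribution disappears since
    \<open>\<kappa> j\<close> and \<open>\<kappa> i'\<close> differ at \<open>q\<close>.\<close>
  have 0: "g q (D q (\<xi> q) (E j)) (E i' q) = 0"
    using codazzi_\<xi>[OF q j i'] ij lam by auto
  have 1: "g q (D q (?b q) (E j)) (E i' q) = (\<Sum>k=1..n. (\<Gamma> q i j k - \<Gamma> q j i k) * \<Gamma> q k j i')"
    unfolding g_D_expansion[OF q b E_field[OF j] frame_tangent(1)[OF i']] 0
    by (simp add: Eb \<Gamma>_def)
  \<comment> \<open>Total symmetry of \<open>Q\<close> gives \<open>(\<kappa> j - \<kappa> i') *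
    \<Gamma>\<^sub>j\<^sub>j\<^sub>i\<^sub>' = 0\<close> near \<open>q\<close>, a proportionality
    with right coefficient identically zero.\<close>
  have 2: "E i q (\<lambda>r. g r (D r (E j r) (E j)) (E i' r)) = 0"
  proof (rule deriv_zero_of_proportional[OF q i j i' j j])
    show "(\<lambda>r. g r (D r (E j r) (E j)) (E i' r)) \<in> smooth_functions A"
      and "(\<lambda>r. g r (D r (E j r) (E j)) (E i' r)) \<in> smooth_functions A"
      using \<Gamma>_smooth[OF j j i'] by (simp_all add: \<Gamma>_def)
    fix r assume r: "r \<in> M \<inter> U"
    show "(\<kappa> j r - \<kappa> i' r) * g r (D r (E j r) (E j)) (E i' r) =
      (\<kappa> j r - \<kappa> j r) * g r (D r (E j r) (E j)) (E i' r)"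
      using Q_sym1[OF r j i' j] Q_sym2[OF r j j i'] \<Gamma>_skew[OF r j j i'] by (auto simp: Q_def \<Gamma>_def)
  qed (use lam in auto)
  \<comment> \<open>Here the Codazzi equation is the proportionality. Its right coefficient
    \<open>\<kappa> i' - \<kappa> i\<close> is zero at \<open>q\<close> but perhaps not around
    it.\<close>
  have 3: "E j q (\<lambda>r. g r (D r (E i r) (E j)) (E i' r)) = 0"
  proof (rule deriv_zero_of_proportional[OF q j i' j i' i])
    show "(\<lambda>r. g r (D r (E i r) (E j)) (E i' r)) \<in> smooth_functions A"
      using \<Gamma>_smooth[OF i j i'] by (simp add: \<Gamma>_def)
    show "(\<lambda>r. g r (D r (E j r) (E i)) (E i' r)) \<in> smooth_functions A"
      using \<Gamma>_smooth[OF j i i'] by (simp add: \<Gamma>_def)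
    fix r assume r: "r \<in> M \<inter> U"
    show "(\<kappa> i' r - \<kappa> j r) * g r (D r (E i r) (E j)) (E i' r) =
      (\<kappa> i' r - \<kappa> i r) * g r (D r (E j r) (E i)) (E i' r)"
      using codazzi[OF r i j i'] by (simp add: \<Gamma>_def)
  qed (use lam in auto)
  \<comment> \<open>\<open>\<kappa> k\<close> differs at \<open>q\<close> from
    \<open>\<kappa> j\<close> or from \<open>lam\<close>, and the corresponding one of the two
    factors vanishes.\<close>
  have 4: "\<Gamma> q j j k * \<Gamma> q i i' k = 0" if k: "k \<in> {1..n}" for k
  proof (cases "\<kappa> k q = \<kappa> j q")
    case True
    have "(\<kappa> k q - \<kappa> i' q) * \<Gamma> q i i' k = 0"
      using Q_sym2[OF q i i' k] Q_sym1[OF q i k i'] Q_sym2[OF q k i i'] lam by (simp add: Q_def)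
    with True lam show ?thesis by simp
  next
    case False
    have "(\<kappa> k q - \<kappa> j q) * \<Gamma> q j j k = 0"
      using Q_sym2[OF q j j k] Q_sym1[OF q j k j] Q_sym2[OF q k j j] by (simp add: Q_def)
    with False show ?thesis by simp
  qed
  have 5: "g q (D q (E j q) (E j)) (D q (E i q) (E i')) =
      C q j j * (if i = i' then lam else 0) + \<kappa> j q * C q i i'"
    using g_D_D[OF q j j i i'] 4 lam by simp
  have 6: "g q (D q (E i q) (E j)) (D q (E j q) (E i')) = (\<Sum>k=1..n. \<Gamma> q i j k * \<Gamma> q j i' k)"
    using g_D_D[OF q i j j i'] ij by simp
  have "g q (curvature D (E i) (E j) (E j) q) (E i' q) = c * (if i = i' then 1 else 0)"
    using curvature_value[OF q E_field[OF i] E_field[OF j] E_field[OF j] E_field[OF i']]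
      EE[OF j j q] EE[OF i i' q] EE[OF i j q] ij by simp
  then show ?thesis
    using curvature_pairing[OF E_field[OF i] E_field[OF j] E_field[OF j] E_field[OF i'], of q]
    unfolding 1 2 3 5 6 sum_subtractf by (auto simp: algebra_simps)
qed

text \<open>
  If \<open>\<kappa> k q\<close> equals \<open>lam\<close> or \<open>\<kappa> j q\<close>, the left-hand side vanishes, in accordance with
  division by zero on the right.
\<close>

lemma gauss_term:
  assumes q: "q \<in> M \<inter> U" and i: "i \<in> {1..n}" and i': "i' \<in> {1..n}" and j: "j \<in> {1..n}"
    and k: "k \<in> {1..n}" and lam: "\<kappa> i q = lam" "\<kappa> i' q = lam" "\<kappa> j q \<noteq> lam"
  shows "\<Gamma> q i j k * \<Gamma> q j i' k - (\<Gamma> q i j k - \<Gamma> q j i k) * \<Gamma> q k j i' =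
    2 * (Q q i j k * Q q i' j k) / ((\<kappa> k q - lam) * (\<kappa> k q - \<kappa> j q))"
proof -
  define a b where "a = \<kappa> k q - lam" and "b = \<kappa> k q - \<kappa> j q"
  have ba: "b - a \<noteq> 0" using lam by (simp add: a_def b_def)
  have e1: "b * \<Gamma> q i j k = Q q i j k" by (simp add: Q_def b_def)
  have e2: "a * \<Gamma> q j i k = Q q i j k"
    using Q_sym1[OF q i j k] lam by (simp add: Q_def a_def)
  have e3: "a * \<Gamma> q j i' k = Q q i' j k"
    using Q_sym1[OF q i' j k] lam by (simp add: Q_def a_def)
  have e4: "(b - a) * \<Gamma> q k j i' = Q q i' j k"
    using Q_sym2[OF q i' j k] Q_sym1[OF q i' k j] Q_sym2[OF q k i' j] lam
    by (simp add: Q_def a_def b_def)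
  have e5: "b * \<Gamma> q i' j k = Q q i' j k" by (simp add: Q_def b_def)
  consider "a = 0" | "b = 0" | "a \<noteq> 0" "b \<noteq> 0" by auto
  then have "\<Gamma> q i j k * \<Gamma> q j i' k - (\<Gamma> q i j k - \<Gamma> q j i k) * \<Gamma> q k j i' =
    2 * (Q q i j k * Q q i' j k) / (a * b)"
  proof cases
    case 1
    then show ?thesis using e1 e2 e3 e4 ba by auto
  next
    case 2
    then show ?thesis using e1 e2 e3 e4 e5 ba by auto
  next
    case 3
    then have eqs: "\<Gamma> q i j k = Q q i j k / b" "\<Gamma> q j i k = Q q i j k / a" "\<Gamma> q j i' k = Q q i' j k / a"
      "\<Gamma> q k j i' = Q q i' j k / (b - a)"
      using e1 e2 e3 e4 ba by (auto simp: field_simps)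
    \<comment> \<open>The factor 2 comes from
      \<open>1/(a b) - (1/b - 1/a)/(b - a) = 2/(a b)\<close>.\<close>
    show ?thesis unfolding eqs using 3 ba by (simp add: divide_simps) (simp add: algebra_simps)
  qed
  then show ?thesis by (simp add: a_def b_def)
qed

section \<open>Summation of the Gauss equations\<close>

lemma cartan_single:
  fixes a :: "nat \<Rightarrow> real"
  assumes q: "q \<in> M \<inter> U" and j: "j \<in> {1..n}" and lam: "\<kappa> j q \<noteq> lam"
    and a: "\<And>i. i \<in> {1..n} \<Longrightarrow> a i \<noteq> 0 \<Longrightarrow> \<kappa> i q = lam"
    and norm: "(\<Sum>i=1..n. a i * a i) = 1"
  shows "c + lam * C q j j + \<kappa> j q * (\<Sum>i=1..n. \<Sum>i'=1..n. a i * a i' * C q i i') =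
    (\<Sum>k=1..n. 2 * (\<Sum>i=1..n. a i * Q q i j k)\<^sup>2 / ((\<kappa> k q - lam) * (\<kappa> k q - \<kappa> j q)))"
proof -
  let ?d = "\<lambda>k. (\<kappa> k q - lam) * (\<kappa> k q - \<kappa> j q)"
  \<comment> \<open>The polarized Gauss equation is contracted with the coordinates \<open>a\<close>
    of a unit eigenvector. Indices with zero coordinate contribute nothing, and for the others
    \<open>\<kappa>\<close> equals \<open>lam\<close>.\<close>
  have "(\<Sum>i=1..n. \<Sum>i'=1..n. a i * a i' * ((if i = i' then c + lam * C q j j else 0) + \<kappa> j q * C q i i'))
    = (\<Sum>i=1..n. \<Sum>i'=1..n. \<Sum>k=1..n. 2 * ((a i * Q q i j k) * (a i' * Q q i' j k)) / ?d k)"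
  proof (intro sum.cong refl)
    fix i i' assume i: "i \<in> {1..n}" and i': "i' \<in> {1..n}"
    show "a i * a i' * ((if i = i' then c + lam * C q j j else 0) + \<kappa> j q * C q i i') =
      (\<Sum>k=1..n. 2 * ((a i * Q q i j k) * (a i' * Q q i' j k)) / ?d k)"
    proof (cases "a i = 0 \<or> a i' = 0")
      case False
      then have l: "\<kappa> i q = lam" "\<kappa> i' q = lam" using a i i' by auto
      have "(if i = i' then c + lam * C q j j else 0) + \<kappa> j q * C q i i' =
          (\<Sum>k=1..n. 2 * (Q q i j k * Q q i' j k) / ?d k)"
        unfolding gauss[OF q i i' j l lam] using gauss_term[OF q i i' j _ l lam] by (intro sum.cong refl) auto
      then show ?thesis by (simp only: sum_distrib_left) (simp add: mult_ac)
    qed auto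
  qed
  also have "\<dots> = (\<Sum>i=1..n. \<Sum>k=1..n. \<Sum>i'=1..n. 2 * ((a i * Q q i j k) * (a i' * Q q i' j k)) / ?d k)"
    by (intro sum.cong refl sum.swap)
  also have "\<dots> = (\<Sum>k=1..n. \<Sum>i=1..n. \<Sum>i'=1..n. 2 * ((a i * Q q i j k) * (a i' * Q q i' j k)) / ?d k)"
    by (rule sum.swap)
  \<comment> \<open>With \<open>k\<close> outermost, the denominator is free of \<open>i\<close> and
    \<open>i'\<close>, and the double sum factors into a square.\<close>
  also have "\<dots> = (\<Sum>k=1..n. 2 * (\<Sum>i=1..n. a i * Q q i j k)\<^sup>2 / ?d k)"
    by (simp only: power2_eq_square sum_product) (simp only: sum_distrib_left sum_divide_distrib)
  finally have R: "(\<Sum>i=1..n. \<Sum>i'=1..n. a i * a i' * ((if i = i' then c + lam * C q j j else 0) + \<kappa> j q * C q i i'))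
    = (\<Sum>k=1..n. 2 * (\<Sum>i=1..n. a i * Q q i j k)\<^sup>2 / ?d k)" .
  have "(\<Sum>i=1..n. \<Sum>i'=1..n. a i * a i' * ((if i = i' then c + lam * C q j j else 0) + \<kappa> j q * C q i i'))
    = (\<Sum>i=1..n. \<Sum>i'=1..n. if i = i' then a i * a i * (c + lam * C q j j) else 0)
      + \<kappa> j q * (\<Sum>i=1..n. \<Sum>i'=1..n. a i * a i' * C q i i')"
    unfolding sum_distrib_left sum.distrib[symmetric]
    by (intro sum.cong refl) (auto simp: algebra_simps)
  also have "(\<Sum>i=1..n. \<Sum>i'=1..n. if i = i' then a i * a i * (c + lam * C q j j) else 0) =
      (\<Sum>i=1..n. a i * a i) * (c + lam * C q j j)"
    by (simp add: sum_distrib_right)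
  finally show ?thesis using R norm by simp
qed

lemma cartan_sum:
  fixes a :: "nat \<Rightarrow> real"
  assumes q: "q \<in> M \<inter> U"
    and a: "\<And>i. i \<in> {1..n} \<Longrightarrow> a i \<noteq> 0 \<Longrightarrow> \<kappa> i q = lam"
    and norm: "(\<Sum>i=1..n. a i * a i) = 1"
  shows "(\<Sum>j | j \<in> {1..n} \<and> \<kappa> j q \<noteq> lam.
    (c + lam * C q j j + \<kappa> j q * (\<Sum>i=1..n. \<Sum>i'=1..n. a i * a i' * C q i i')) / (lam - \<kappa> j q)) = 0"
proof -
  define s where "s j k = (\<Sum>i=1..n. a i * Q q i j k)" for j k
  \<comment> \<open>The square is symmetric in \<open>j\<close> and \<open>k\<close> by the symmetry
    of \<open>Q\<close>, whereas the product of the three denominators changes sign when they are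
    exchanged.\<close>
  define F where "F j k = 2 * (s j k)\<^sup>2 / ((\<kappa> k q - lam) * (\<kappa> k q - \<kappa> j q)) / (lam - \<kappa> j q)" for j k
  have s: "s j k = s k j" if "j \<in> {1..n}" "k \<in> {1..n}" for j k
    unfolding s_def using Q_sym2[OF q _ that] by (intro sum.cong) auto
  have F: "F j k = - F k j" if "j \<in> {1..n}" "k \<in> {1..n}" for j k
  proof -
    have "(\<kappa> k q - lam) * (\<kappa> k q - \<kappa> j q) * (lam - \<kappa> j q) =
        - ((\<kappa> j q - lam) * (\<kappa> j q - \<kappa> k q) * (lam - \<kappa> k q))"
      by (simp add: algebra_simps)
    then show ?thesis unfolding F_def s[OF that] divide_divide_eq_left by simp
  qed
  have "(\<Sum>j | j \<in> {1..n} \<and> \<kappa> j q \<noteq> lam.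
      (c + lam * C q j j + \<kappa> j q * (\<Sum>i=1..n. \<Sum>i'=1..n. a i * a i' * C q i i')) / (lam - \<kappa> j q))
    = (\<Sum>j | j \<in> {1..n} \<and> \<kappa> j q \<noteq> lam. \<Sum>k=1..n. F j k)"
  proof (rule sum.cong[OF refl])
    fix j assume "j \<in> {j. j \<in> {1..n} \<and> \<kappa> j q \<noteq> lam}"
    then have j: "j \<in> {1..n}" "\<kappa> j q \<noteq> lam" by auto
    have "c + lam * C q j j + \<kappa> j q * (\<Sum>i=1..n. \<Sum>i'=1..n. a i * a i' * C q i i') =
        (\<Sum>k=1..n. 2 * (s j k)\<^sup>2 / ((\<kappa> k q - lam) * (\<kappa> k q - \<kappa> j q)))"
      unfolding s_def by (rule cartan_single[OF q j _ norm]) (rule a)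
    then show "(c + lam * C q j j + \<kappa> j q * (\<Sum>i=1..n. \<Sum>i'=1..n. a i * a i' * C q i i')) / (lam - \<kappa> j q) =
        (\<Sum>k=1..n. F j k)"
      by (simp only: F_def sum_divide_distrib)
  qed
  \<comment> \<open>The added indices have \<open>\<kappa> j q = lam\<close>, where division by zero
    makes \<open>F j k\<close> zero.\<close>
  also have "\<dots> = (\<Sum>j=1..n. \<Sum>k=1..n. F j k)"
    by (rule sum.mono_neutral_left) (auto simp: F_def)
  finally have S: "(\<Sum>j | j \<in> {1..n} \<and> \<kappa> j q \<noteq> lam.
      (c + lam * C q j j + \<kappa> j q * (\<Sum>i=1..n. \<Sum>i'=1..n. a i * a i' * C q i i')) / (lam - \<kappa> j q))
    = (\<Sum>j=1..n. \<Sum>k=1..n. F j k)" .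
  have "(\<Sum>j=1..n. \<Sum>k=1..n. F j k) = (\<Sum>j=1..n. \<Sum>k=1..n. - F k j)"
    using F by (intro sum.cong refl) blast
  also have "\<dots> = - (\<Sum>j=1..n. \<Sum>k=1..n. F j k)"
    by (subst sum.swap) (simp add: sum_negf)
  finally show ?thesis using S by simp
qed

end

section \<open>Cartan's identity\<close>

lemma deriv_along_eq:
  assumes v: "v \<in> tangent_sub A M q" and h: "h \<in> smooth_functions A" and near: "agree_near M q h f"
  shows "deriv_along A M q v f = v h"
  unfolding deriv_along_def
proof (rule the_equality)
  fix d assume "\<exists>h\<in>smooth_functions A. agree_near M q h f \<and> d = v h"
  then obtain h' where h': "h' \<in> smooth_functions A" "agree_near M q h' f" "d = v h'" by blast
  obtain O1 O2 where "open O1" "q \<in> O1" "\<forall>r\<in>M \<inter> O1. h r = f r"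
    "open O2" "q \<in> O2" "\<forall>r\<in>M \<inter> O2. h' r = f r"
    using near h'(2) unfolding agree_near_def by blast
  then have "agree_near M q h' h"
    unfolding agree_near_def by (intro exI[of _ "O1 \<inter> O2"]) auto
  then show "d = v h" using tangent_sub_cong[OF v h'(1) h] h'(3) by simp
qed (use h near in blast)

text \<open>Links the ambient fields \<xi>, \<open>N\<close> to the given sections \<xi>',
  \<open>N'\<close> with which the shape operators are formed; the screen enters only through its
  fibre at \<open>p\<close>.\<close>

locale extended_eigenframe = null_eigenframe A g D n M U E \<xi> N c \<kappa>
  for A :: "('m::topological_space, 'a::euclidean_space) atlas" and g D n M U E \<xi> N c \<kappa> +
  fixes p :: 'm and S :: "'m \<Rightarrow> 'm tvec set" and \<xi>' N' :: "'m vfield"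
  assumes p: "p \<in> M \<inter> U"
    and \<xi>': "q \<in> M \<inter> U \<Longrightarrow> \<xi> q = \<xi>' q"
    and N': "q \<in> M \<inter> U \<Longrightarrow> N q = N' q"
    and S_span: "S p = span ((\<lambda>j. E j p) ` {1..n})"
    and S_tangent: "v \<in> S p \<Longrightarrow> v \<in> tangent_sub A M p"
    and N_S: "v \<in> S p \<Longrightarrow> g p (N p) v = 0"
    and \<tau>: "v \<in> S p \<Longrightarrow> null_tau A g D M \<xi>' N' p v = 0"
begin

section \<open>Screen vectors at p in frame coordinates\<close>

lemma S_vec: "v \<in> S p \<Longrightarrow> v \<in> tangent_space A p"
  by (rule tangent_sub_tangent[OF S_tangent])

lemma E_in_S: "j \<in> {1..n} \<Longrightarrow> E j p \<in> S p"
  unfolding S_span by (intro span_base imageI)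

lemma shape_\<xi>_S: "v \<in> S p \<Longrightarrow> shape_\<xi> A g D M \<xi>' N' p v = - D p v \<xi>"
  using p \<xi>' by (intro shape_\<xi>_eq S_tangent \<tau> agree_near_iff_inter[OF U]) auto

lemma shape_N_S: "v \<in> S p \<Longrightarrow> shape_N A g D M \<xi>' N' p v = - D p v N"
  using p N' by (intro shape_N_eq S_tangent \<tau> agree_near_iff_inter[OF U]) auto

lemma S_orthogonal:
  assumes "v \<in> S p"
  shows "g p v (\<xi> p) = 0" "g p v (N p) = 0"
  using \<xi>_perp[OF p S_tangent[OF assms]] N_S[OF assms] g_sym[OF S_vec[OF assms]] frame_tangent
  by simp_all

lemma S_expansion:
  assumes v: "v \<in> S p"
  shows "v = (\<Sum>k=1..n. g p v (E k p) *\<^sub>R E k p)"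
  using frame_expansion[OF p S_vec[OF v]]
  by (simp only: S_orthogonal[OF v] scaleR_zero_left add_0_right)

lemma g_D_S:
  assumes v: "v \<in> S p" and Y: "Y \<in> vector_fields A" and w: "w \<in> tangent_space A p"
  shows "g p (D p v Y) w = (\<Sum>k=1..n. g p v (E k p) * g p (D p (E k p) Y) w)"
  using g_D_expansion[OF p S_tangent[OF v] Y w] by (simp only: S_orthogonal[OF v] mult_zero_left add_0_right)

text \<open>Comparing the \<open>E k\<close> coordinates of both sides of the eigenvalue equation
  multiplies the same coordinate once by \<open>lam\<close> and once by
  \<open>\<kappa> k p\<close>.\<close>

lemma S_eigenvector_coordinates:
  assumes v: "v \<in> S p" and eig: "shape_\<xi> A g D M \<xi>' N' p v = lam *\<^sub>R v"
    and k: "k \<in> {1..n}" and nz: "g p v (E k p) \<noteq> 0"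
  shows "\<kappa> k p = lam"
proof -
  have "D p v \<xi> = (- lam) *\<^sub>R v"
    using eig shape_\<xi>_S[OF v] by (metis minus_minus scaleR_minus_left)
  then have "g p (D p v \<xi>) (E k p) = - lam * g p v (E k p)"
    using g_scale_left[OF S_vec[OF v] frame_tangent(1)[OF k], of "- lam"] by simp
  moreover have "g p (D p v \<xi>) (E k p) = - g p v (E k p) * \<kappa> k p"
    unfolding g_D_S[OF v \<xi>_field frame_tangent(1)[OF k]] by (rule sum_\<kappa>[OF p k])
  ultimately show ?thesis using nz by simp
qed

text \<open>Turns the term of the theorem that contains \<open>A\<^sub>N X\<close> into the
  quadratic form of \<open>C\<close> at the frame coordinates of the vector, the shape it has in
  \<open>cartan_sum\<close>.\<close>

lemma g_shape_N:
  assumes v: "v \<in> S p"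
  shows "g p (shape_N A g D M \<xi>' N' p v) v =
    (\<Sum>i=1..n. \<Sum>j=1..n. g p v (E i p) * g p v (E j p) * C p i j)"
proof -
  have DN: "g p (D p (E i p) N) v = - (\<Sum>j=1..n. g p v (E j p) * C p i j)" if i: "i \<in> {1..n}" for i
  proof -
    have T: "D p (E i p) N \<in> tangent_space A p"
      by (intro D_tangent frame_tangent i N_field)
    have "g p (D p (E i p) N) v = (\<Sum>j=1..n. g p (D p (E i p) N) (E j p) * g p v (E j p))"
      using g_expansion[OF p T S_vec[OF v]] S_orthogonal[OF v] by simp
    also have "\<dots> = (\<Sum>j=1..n. - (g p v (E j p) * C p i j))"
    proof (rule sum.cong[OF refl])
      fix j assume j: "j \<in> {1..n}"
      show "g p (D p (E i p) N) (E j p) * g p v (E j p) = - (g p v (E j p) * C p i j)"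
        using D_E_N[OF p E_tangent[OF i p] j] by (simp add: C_def)
    qed
    finally show ?thesis by (simp only: sum_negf)
  qed
  have "g p (shape_N A g D M \<xi>' N' p v) v = - g p (D p v N) v"
    unfolding shape_N_S[OF v] by (intro g_uminus_left D_tangent S_vec v N_field)
  also have "\<dots> = - (\<Sum>i=1..n. g p v (E i p) * g p (D p (E i p) N) v)"
    by (simp only: g_D_S[OF v N_field S_vec[OF v]])
  also have "\<dots> = (\<Sum>i=1..n. g p v (E i p) * (\<Sum>j=1..n. g p v (E j p) * C p i j))"
    unfolding sum_negf[symmetric]
    by (intro sum.cong refl) (simp only: DN mult_minus_right minus_minus)
  finally show ?thesis by (simp only: sum_distrib_left mult.assoc)
qed

lemma g_shape_N_frame:
  assumes j: "j \<in> {1..n}"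
  shows "g p (shape_N A g D M \<xi>' N' p (E j p)) (E j p) = C p j j"
proof -
  have "g p (shape_N A g D M \<xi>' N' p (E j p)) (E j p) = - g p (D p (E j p) N) (E j p)"
    unfolding shape_N_S[OF E_in_S[OF j]] by (intro g_uminus_left D_tangent frame_tangent j N_field)
  then show ?thesis using D_E_N[OF p E_tangent[OF j p] j] by (simp add: C_def)
qed

lemma cartan_identity:
  assumes x: "x \<in> S p" and unit: "g p x x = 1" and eig: "shape_\<xi> A g D M \<xi>' N' p x = lam *\<^sub>R x"
  shows "(\<Sum>j | j \<in> {1..n} \<and> \<kappa> j p \<noteq> lam.
    (c + lam * g p (shape_N A g D M \<xi>' N' p (E j p)) (E j p)
      + \<kappa> j p * g p (shape_N A g D M \<xi>' N' p x) x) / (lam - \<kappa> j p)) = 0"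
proof -
  have norm: "(\<Sum>i=1..n. g p x (E i p) * g p x (E i p)) = 1"
    using g_expansion[OF p S_vec[OF x] S_vec[OF x]] S_orthogonal[OF x] unit by simp
  have "(\<Sum>j | j \<in> {1..n} \<and> \<kappa> j p \<noteq> lam.
      (c + lam * C p j j + \<kappa> j p * (\<Sum>i=1..n. \<Sum>i'=1..n. g p x (E i p) * g p x (E i' p) * C p i i'))
        / (lam - \<kappa> j p)) = 0"
    by (rule cartan_sum[OF p _ norm]) (rule S_eigenvector_coordinates[OF x eig])
  then show ?thesis
    unfolding g_shape_N[OF x] by (simp add: g_shape_N_frame)
qed

lemma S_eigenvector_frame:
  assumes j: "j \<in> {1..n}"
  shows "shape_\<xi> A g D M \<xi>' N' p (E j p) = \<kappa> j p *\<^sub>R E j p"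
  unfolding shape_\<xi>_S[OF E_in_S[OF j]] D_\<xi>[OF j p] by simp

section \<open>Eigenspaces, multiplicities and the quasi-conformal case\<close>

lemma frame_independent:
  assumes "K \<subseteq> {1..n}"
  shows "inj_on (\<lambda>j. E j p) K" and "independent ((\<lambda>j. E j p) ` K)"
proof -
  have fin: "finite K" using assms finite_subset by blast
  have T: "E k p \<in> tangent_space A p" if "k \<in> K" for k
    using that assms by (intro frame_tangent) auto
  have dual: "g p (E i p) (E j p) = (if i = j then 1 else 0)" if "i \<in> K" "j \<in> K" for i j
    using that assms by (intro EE[OF _ _ p]) auto
  show "inj_on (\<lambda>j. E j p) K"
    by (rule dual_family_inj[OF fin, of _ p "\<lambda>j. E j p"]) (fact T dual)+
  show "independent ((\<lambda>j. E j p) ` K)"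
    by (rule dual_family_independent[OF fin, of _ p "\<lambda>j. E j p"]) (fact T dual)+
qed

lemma screen_eigenspace_eq:
  "screen_eigenspace A g D M S \<xi>' N' p \<mu> = span ((\<lambda>j. E j p) ` {j\<in>{1..n}. \<kappa> j p = \<mu>})"
  (is "?L = span ?B")
proof
  show "?L \<subseteq> span ?B"
  proof
    fix v assume "v \<in> ?L"
    then have v: "v \<in> S p" "shape_\<xi> A g D M \<xi>' N' p v = \<mu> *\<^sub>R v"
      by (auto simp: screen_eigenspace_def)
    have "(\<Sum>k=1..n. g p v (E k p) *\<^sub>R E k p) \<in> span ?B"
    proof (rule span_sum)
      fix k assume k: "k \<in> {1..n}"
      show "g p v (E k p) *\<^sub>R E k p \<in> span ?B"
      proof (cases "g p v (E k p) = 0")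
        case True
        then show ?thesis by (simp add: span_zero)
      next
        case False
        then have "E k p \<in> ?B"
          using S_eigenvector_coordinates[OF v k] k by (intro imageI) simp
        then show ?thesis by (intro span_scale span_base)
      qed
    qed
    then show "v \<in> span ?B" by (simp only: S_expansion[OF v(1), symmetric])
  qed
  have sub: "subspace ?L"
  proof (rule subspaceI)
    have S: "subspace (S p)" by (simp add: S_span)
    have eq: "?L = {v \<in> S p. - D p v \<xi> = \<mu> *\<^sub>R v}"
      using shape_\<xi>_S by (auto simp: screen_eigenspace_def)
    show "0 \<in> ?L"
      unfolding eq using D_zero_dir[OF \<xi>_field] subspace_0[OF S] by simp
    show "u + v \<in> ?L" if "u \<in> ?L" "v \<in> ?L" for u v
    proof -
      have uv: "u \<in> S p" "v \<in> S p" "- D p u \<xi> = \<mu> *\<^sub>R u" "- D p v \<xi> = \<mu> *\<^sub>R v"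
        using that unfolding eq by blast+
      have "- D p (u + v) \<xi> = - D p u \<xi> + - D p v \<xi>"
        by (simp only: D_add_dir[OF S_vec[OF uv(1)] S_vec[OF uv(2)] \<xi>_field] minus_add_distrib)
      also have "\<dots> = \<mu> *\<^sub>R (u + v)" by (simp only: uv scaleR_add_right)
      finally show ?thesis unfolding eq using subspace_add[OF S uv(1,2)] by simp
    qed
    show "a *\<^sub>R v \<in> ?L" if "v \<in> ?L" for a v
    proof -
      have v: "v \<in> S p" "- D p v \<xi> = \<mu> *\<^sub>R v"
        using that unfolding eq by blast+
      have "- D p (a *\<^sub>R v) \<xi> = a *\<^sub>R (- D p v \<xi>)"
        by (simp only: D_scale_dir[OF S_vec[OF v(1)] \<xi>_field] scaleR_minus_right)
      also have "\<dots> = \<mu> *\<^sub>R (a *\<^sub>R v)" by (simp only: v scaleR_left_commute)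
      finally show ?thesis unfolding eq using subspace_scale[OF S v(1)] by simp
    qed
  qed
  show "span ?B \<subseteq> ?L"
  proof (rule span_minimal[OF _ sub])
    show "?B \<subseteq> ?L"
      using E_in_S S_eigenvector_frame by (auto simp: screen_eigenspace_def)
  qed
qed

text \<open>Translates multiplicities, given as dimensions of eigenspaces, into numbers of frame
  indices.\<close>

lemma dim_screen_eigenspace:
  "dim (screen_eigenspace A g D M S \<xi>' N' p \<mu>) = card {j\<in>{1..n}. \<kappa> j p = \<mu>}"
proof -
  let ?K = "{j\<in>{1..n}. \<kappa> j p = \<mu>}"
  have K: "?K \<subseteq> {1..n}" by blast
  show ?thesis
    unfolding screen_eigenspace_eq dim_span dim_eq_card_independent[OF frame_independent(2)[OF K]]
    by (rule card_image[OF frame_independent(1)[OF K]])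
qed

lemma screen_principal_curvatures_eq:
  "screen_principal_curvatures A g D M S \<xi>' N' p = (\<lambda>j. \<kappa> j p) ` {1..n}"
proof (intro equalityI subsetI)
  fix \<mu> assume "\<mu> \<in> screen_principal_curvatures A g D M S \<xi>' N' p"
  then obtain v where v: "v \<in> S p" "shape_\<xi> A g D M \<xi>' N' p v = \<mu> *\<^sub>R v" "v \<noteq> 0"
    by (auto simp: screen_principal_curvatures_def screen_eigenspace_def)
  have "\<exists>k\<in>{1..n}. g p v (E k p) \<noteq> 0"
  proof (rule ccontr)
    assume "\<not> (\<exists>k\<in>{1..n}. g p v (E k p) \<noteq> 0)"
    then have "(\<Sum>k=1..n. g p v (E k p) *\<^sub>R E k p) = 0"
      by (intro sum.neutral) simp
    then show False using S_expansion[OF v(1)] v(3) by simp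
  qed
  then show "\<mu> \<in> (\<lambda>j. \<kappa> j p) ` {1..n}"
    using S_eigenvector_coordinates[OF v(1,2)] by blast
next
  fix \<mu> assume "\<mu> \<in> (\<lambda>j. \<kappa> j p) ` {1..n}"
  then obtain j where j: "j \<in> {1..n}" "\<mu> = \<kappa> j p" by blast
  have "E j p \<noteq> 0"
  proof
    assume "E j p = 0"
    then show False
      using EE[OF j(1) j(1) p] g_zero_left[OF frame_tangent(1)[OF j(1)], of p] by simp
  qed
  then show "\<mu> \<in> screen_principal_curvatures A g D M S \<xi>' N' p"
    using E_in_S[OF j(1)] S_eigenvector_frame[OF j(1)] j(2)
    by (auto simp: screen_principal_curvatures_def screen_eigenspace_def)
qed

text \<open>A frame vector \<open>E s\<close> with eigenvalue \<open>\<mu> i\<close> serves as unit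
  eigenvector. Quasi-conformality makes each \<open>E j\<close> an eigenvector of
  \<open>A\<^sub>N\<close> with eigenvalue \<open>\<phi> * \<kappa> j p + \<psi>\<close>, which
  yields the stated numerators.\<close>

lemma cartan_identity_quasi_conformal:
  fixes l :: nat and m :: "nat \<Rightarrow> nat"
  assumes qc: "\<And>v. v \<in> S p \<Longrightarrow> shape_N A g D M \<xi>' N' p v = \<phi> *\<^sub>R shape_\<xi> A g D M \<xi>' N' p v + \<psi> *\<^sub>R v"
    and inj: "inj_on \<mu> {1..l}"
    and spec: "\<mu> ` {1..l} = screen_principal_curvatures A g D M S \<xi>' N' p"
    and mult: "\<And>i. i \<in> {1..l} \<Longrightarrow> m i = dim (screen_eigenspace A g D M S \<xi>' N' p (\<mu> i))"
    and i: "i \<in> {1..l}"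
  shows "(\<Sum>j\<in>{1..l} - {i}. real (m j) * ((c + 2 * \<phi> * \<mu> i * \<mu> j + \<psi> * (\<mu> i + \<mu> j)) / (\<mu> i - \<mu> j))) = 0"
proof -
  let ?f = "\<lambda>y. (c + 2 * \<phi> * \<mu> i * y + \<psi> * (\<mu> i + y)) / (\<mu> i - y)"
  let ?K = "{j. j \<in> {1..n} \<and> \<kappa> j p \<noteq> \<mu> i}"
  have "\<mu> i \<in> (\<lambda>j. \<kappa> j p) ` {1..n}"
    unfolding screen_principal_curvatures_eq[symmetric] spec[symmetric] using i by (rule imageI)
  then obtain s where s: "s \<in> {1..n}" "\<mu> i = \<kappa> s p" by blast
  have gN: "g p (shape_N A g D M \<xi>' N' p (E j p)) (E j p) = \<phi> * \<kappa> j p + \<psi>" if j: "j \<in> {1..n}" for j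
  proof -
    have "shape_N A g D M \<xi>' N' p (E j p) = (\<phi> * \<kappa> j p) *\<^sub>R E j p + \<psi> *\<^sub>R E j p"
      unfolding qc[OF E_in_S[OF j]] S_eigenvector_frame[OF j] by simp
    then show ?thesis
      using g_linear_comb_left[OF frame_tangent(1)[OF j] frame_tangent(1)[OF j] frame_tangent(1)[OF j], of p]
        EE[OF j j p] by simp
  qed
  have "(\<Sum>j\<in>?K. ?f (\<kappa> j p)) = 0"
  proof -
    have "(\<Sum>j\<in>?K. ?f (\<kappa> j p)) = (\<Sum>j\<in>?K.
        (c + \<mu> i * g p (shape_N A g D M \<xi>' N' p (E j p)) (E j p)
        + \<kappa> j p * g p (shape_N A g D M \<xi>' N' p (E s p)) (E s p)) / (\<mu> i - \<kappa> j p))"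
    proof (rule sum.cong[OF refl])
      fix j assume "j \<in> ?K"
      then have j: "j \<in> {1..n}" by blast
      show "?f (\<kappa> j p) = (c + \<mu> i * g p (shape_N A g D M \<xi>' N' p (E j p)) (E j p)
          + \<kappa> j p * g p (shape_N A g D M \<xi>' N' p (E s p)) (E s p)) / (\<mu> i - \<kappa> j p)"
        unfolding gN[OF j] gN[OF s(1)] s(2) by (simp add: algebra_simps)
    qed
    also have "\<dots> = 0"
      using cartan_identity[OF E_in_S[OF s(1)] _ S_eigenvector_frame[OF s(1)]] EE[OF s(1) s(1) p]
      by (simp only: s(2)) simp
    finally show ?thesis .
  qed
  \<comment> \<open>Frame indices are grouped by eigenvalue; each group has constant summand and
    multiplicity many elements.\<close>
  moreover have "(\<Sum>j\<in>?K. ?f (\<kappa> j p)) =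
      (\<Sum>y\<in>\<mu> ` ({1..l} - {i}). \<Sum>j\<in>{j\<in>?K. \<kappa> j p = y}. ?f (\<kappa> j p))"
  proof (rule sum.group[symmetric])
    show "(\<lambda>j. \<kappa> j p) ` ?K \<subseteq> \<mu> ` ({1..l} - {i})"
    proof (rule image_subsetI)
      fix j assume j: "j \<in> ?K"
      then have "\<kappa> j p \<in> \<mu> ` {1..l}"
        unfolding spec screen_principal_curvatures_eq by blast
      then obtain k where "k \<in> {1..l}" "\<kappa> j p = \<mu> k" by blast
      with j show "\<kappa> j p \<in> \<mu> ` ({1..l} - {i})" by blast
    qed
  qed auto
  moreover have "\<dots> = (\<Sum>j\<in>{1..l} - {i}. real (m j) * ?f (\<mu> j))"
  proof (subst sum.reindex)
    show "inj_on \<mu> ({1..l} - {i})" using inj by (rule inj_on_subset) blast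
    show "sum ((\<lambda>y. \<Sum>j\<in>{j\<in>?K. \<kappa> j p = y}. ?f (\<kappa> j p)) \<circ> \<mu>) ({1..l} - {i}) =
        (\<Sum>j\<in>{1..l} - {i}. real (m j) * ?f (\<mu> j))"
    proof (rule sum.cong[OF refl])
      fix k assume k: "k \<in> {1..l} - {i}"
      then have "\<mu> k \<noteq> \<mu> i" using inj_onD[OF inj, of k i] i by blast
      then have "{j\<in>?K. \<kappa> j p = \<mu> k} = {j\<in>{1..n}. \<kappa> j p = \<mu> k}" by auto
      moreover have "m k = card {j\<in>{1..n}. \<kappa> j p = \<mu> k}"
        using mult[of k] k by (simp add: dim_screen_eigenspace)
      moreover have "(\<Sum>j\<in>{j\<in>{1..n}. \<kappa> j p = \<mu> k}. ?f (\<kappa> j p)) =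
          (\<Sum>j\<in>{j\<in>{1..n}. \<kappa> j p = \<mu> k}. ?f (\<mu> k))"
        by (rule sum.cong) auto
      ultimately show "((\<lambda>y. \<Sum>j\<in>{j\<in>?K. \<kappa> j p = y}. ?f (\<kappa> j p)) \<circ> \<mu>) k = real (m k) * ?f (\<mu> k)"
        by (simp only: o_def sum_constant)
    qed
  qed
  ultimately show ?thesis by simp
qed

end

section \<open>Extension of sections on M to ambient fields\<close>

lemma screen_subset_tangent_sub:
  assumes S: "screen_distribution A g M S" and q: "q \<in> M" and v: "v \<in> S q"
  shows "v \<in> tangent_sub A M q"
proof -
  have "S q \<inter> tangent_perp A g M q = {0}"
    and sum: "{s + r | s r. s \<in> S q \<and> r \<in> tangent_perp A g M q} = tangent_sub A M q"
    using S q by (auto simp: screen_distribution_def)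
  then have "0 \<in> tangent_perp A g M q" by blast
  then have "v + 0 \<in> {s + r | s r. s \<in> S q \<and> r \<in> tangent_perp A g M q}"
    using v by blast
  then show ?thesis unfolding sum by simp
qed

lemma tangent_perp_subset_tangent_sub:
  assumes S: "screen_distribution A g M S" and q: "q \<in> M" and v: "v \<in> tangent_perp A g M q"
  shows "v \<in> tangent_sub A M q"
proof -
  have "S q \<inter> tangent_perp A g M q = {0}"
    and sum: "{s + r | s r. s \<in> S q \<and> r \<in> tangent_perp A g M q} = tangent_sub A M q"
    using S q by (auto simp: screen_distribution_def)
  then have "0 \<in> S q" by blast
  then have "0 + v \<in> {s + r | s r. s \<in> S q \<and> r \<in> tangent_perp A g M q}"
    using v by blast
  then show ?thesis unfolding sum by simp
qed

text \<open>Primes now mark the ambient extensions, the reverse of the convention in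
  \<open>extended_eigenframe\<close>. Each section has its own neighbourhood of agreement around
  \<open>p\<close>; there are finitely many, and \<open>U\<close> is their intersection with the
  domain of the frame.\<close>

lemma eigenframe_extension:
  fixes A :: "('m::topological_space, 'a::euclidean_space) atlas"
  assumes dim: "DIM('a) = n + 2"
    and lorentz: "lorentzian_metric A g" and lc: "levi_civita A g D"
    and cc: "constant_curvature A g D c"
    and S: "screen_distribution A g M S"
    and \<xi>: "null_section A g M \<xi>" and N: "null_transversal A g M S \<xi> N"
    and iso: "null_screen_isoparametric A g D M S \<xi> N"
    and \<tau>: "\<forall>q\<in>M. \<forall>v\<in>S q. null_tau A g D M \<xi> N q v = 0"
    and p: "p \<in> M" "p \<in> W" and frame: "screen_eigenframe A g D M S \<xi> N W E \<kappa>"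
  obtains U E' \<xi>' N' \<kappa>' where
    "extended_eigenframe A g D n M U E' \<xi>' N' c \<kappa>' p S \<xi> N"
    and "\<And>j. j \<in> {1..n} \<Longrightarrow> E' j p = E j p" and "\<And>j. j \<in> {1..n} \<Longrightarrow> \<kappa>' j p = \<kappa> j p"
proof -
  have n: "DIM('a) - 2 = n" using dim by simp
  interpret lorentz_space A g D by standard (fact lorentz lc)+
  note frame' = frame[unfolded screen_eigenframe_def n]
  obtain U0 where U0: "open U0" "W = M \<inter> U0"
    using frame' by (auto simp: openin_open)
  have "\<forall>j\<in>{1..n}. \<exists>Y O1. Y \<in> vector_fields A \<and> open O1 \<and> p \<in> O1 \<and> (\<forall>q\<in>M \<inter> O1. Y q = E j q)"
    using frame' p(2) unfolding smooth_field_along_def agree_near_def by meson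
  then obtain E' VE where E': "\<And>j. j \<in> {1..n} \<Longrightarrow> E' j \<in> vector_fields A \<and> open (VE j) \<and> p \<in> VE j
      \<and> (\<forall>q\<in>M \<inter> VE j. E' j q = E j q)"
    by metis
  obtain \<xi>' V\<xi> where \<xi>': "\<xi>' \<in> vector_fields A" "open V\<xi>" "p \<in> V\<xi>" "\<forall>q\<in>M \<inter> V\<xi>. \<xi>' q = \<xi> q"
    using \<xi> p(1) unfolding null_section_def smooth_field_along_def agree_near_def by meson
  obtain N' VN where N': "N' \<in> vector_fields A" "open VN" "p \<in> VN" "\<forall>q\<in>M \<inter> VN. N' q = N q"
    using N p(1) unfolding null_transversal_def smooth_field_along_def agree_near_def by meson
  define U where "U = U0 \<inter> V\<xi> \<inter> VN \<inter> (\<Inter>j\<in>{1..n}. VE j)"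
  have openU: "open U"
    unfolding U_def using U0(1) \<xi>'(2) N'(2) E' by (intro open_Int open_INT ballI) auto
  have pU: "p \<in> M \<inter> U"
    unfolding U_def using U0(2) \<xi>'(3) N'(3) E' p by auto
  have E'_eq: "E' j q = E j q" if "j \<in> {1..n}" "q \<in> M \<inter> U" for j q
    using that E'[OF that(1)] unfolding U_def by blast
  have \<xi>'_eq: "\<xi>' q = \<xi> q" and N'_eq: "N' q = N q" and qW: "q \<in> W" and qM: "q \<in> M"
    if "q \<in> M \<inter> U" for q
    using that \<xi>'(4) N'(4) U0(2) unfolding U_def by blast+
  have span: "span ((\<lambda>j. E j q) ` {1..n}) = S q"
    and ortho: "\<And>i j. i \<in> {1..n} \<Longrightarrow> j \<in> {1..n} \<Longrightarrow> g q (E i q) (E j q) = (if i = j then 1 else 0)"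
    and eig: "\<And>j. j \<in> {1..n} \<Longrightarrow> shape_\<xi> A g D M \<xi> N q (E j q) = \<kappa> j q *\<^sub>R E j q"
    if "q \<in> M \<inter> U" for q
    using frame' qW[OF that] by blast+
  have ES: "E j q \<in> S q" if "j \<in> {1..n}" "q \<in> M \<inter> U" for j q
    unfolding span[OF that(2), symmetric] using that(1) by (intro span_base imageI)
  have perp: "\<xi> q \<in> tangent_perp A g M q" if "q \<in> M" for q
    using \<xi> that by (simp add: null_section_def)
  interpret null_frame A g D n M U E' \<xi>' N'
  proof
    fix q assume q: "q \<in> M \<inter> U"
    show "\<xi>' q \<in> tangent_sub A M q"
      unfolding \<xi>'_eq[OF q] by (rule tangent_perp_subset_tangent_sub[OF S qM[OF q] perp[OF qM[OF q]]])
    show "g q (N' q) (N' q) = 0" "g q (\<xi>' q) (N' q) = 1"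
      unfolding N'_eq[OF q] \<xi>'_eq[OF q] using N qM[OF q] by (simp_all add: null_transversal_def)
    show "g q (\<xi>' q) w = 0" if "w \<in> tangent_sub A M q" for w
      unfolding \<xi>'_eq[OF q] using perp[OF qM[OF q]] that by (simp add: tangent_perp_def)
    fix j assume j: "j \<in> {1..n}"
    show "E' j q \<in> tangent_sub A M q"
      unfolding E'_eq[OF j q] by (rule screen_subset_tangent_sub[OF S qM[OF q] ES[OF j q]])
    show "g q (N' q) (E' j q) = 0"
      unfolding E'_eq[OF j q] N'_eq[OF q] using N qM[OF q] ES[OF j q] by (simp add: null_transversal_def)
    fix i assume i: "i \<in> {1..n}"
    show "g q (E' i q) (E' j q) = (if i = j then 1 else 0)"
      unfolding E'_eq[OF j q] E'_eq[OF i q] by (rule ortho[OF q i j])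
  qed (use dim openU E' \<xi>'(1) N'(1) in auto)
  have near: "agree_near M q \<xi>' \<xi>" if "q \<in> M \<inter> U" for q
    using that \<xi>'_eq by (intro agree_near_iff_inter[OF openU]) auto
  have D_\<xi>': "D q (E' j q) \<xi>' = - \<kappa> j q *\<^sub>R E' j q" if j: "j \<in> {1..n}" and q: "q \<in> M \<inter> U" for j q
  proof -
    have "null_tau A g D M \<xi> N q (E' j q) = 0"
      using \<tau> qM[OF q] ES[OF j q] E'_eq[OF j q] by simp
    from shape_\<xi>_eq[OF q E_tangent[OF j q] near[OF q] \<xi>'_eq[OF q, symmetric] this]
    have "- D q (E' j q) \<xi>' = \<kappa> j q *\<^sub>R E' j q"
      using eig[OF q j] E'_eq[OF j q] by simp
    then show ?thesis by (metis minus_minus scaleR_minus_left)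
  qed
  \<comment> \<open>The eigenvalue functions are recovered as products of ambient fields, which
    makes them smooth on the whole manifold while agreeing with \<kappa> on
    \<open>M \<inter> U\<close>.\<close>
  define \<kappa>' where "\<kappa>' j q = - g q (D q (E' j q) \<xi>') (E' j q)" for j q
  have \<kappa>'_eq: "\<kappa>' j q = \<kappa> j q" if j: "j \<in> {1..n}" and q: "q \<in> M \<inter> U" for j q
    unfolding \<kappa>'_def D_\<xi>'[OF j q] g_scale_left[OF frame_tangent(1)[OF j] frame_tangent(1)[OF j]]
    using EE[OF j j q] by simp
  have \<kappa>'_smooth: "\<kappa>' j \<in> smooth_functions A" if "j \<in> {1..n}" for j
    using smooth_functions_uminus[OF g_smooth[OF D_field[OF E_field[OF that] \<xi>_field] E_field[OF that]]]
    by (simp add: \<kappa>'_def[abs_def])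
  have "extended_eigenframe A g D n M U E' \<xi>' N' c \<kappa>' p S \<xi> N"
  proof
    fix j q assume j: "j \<in> {1..n}" and q: "q \<in> M \<inter> U"
    show "D q (E' j q) \<xi>' = - \<kappa>' j q *\<^sub>R E' j q"
      unfolding \<kappa>'_eq[OF j q] by (rule D_\<xi>'[OF j q])
    fix i assume i: "i \<in> {1..n}"
    have "deriv_along A M q (E' i q) (\<kappa> j) = 0"
      using iso frame qW[OF q] ES[OF i q] E'_eq[OF i q] j unfolding null_screen_isoparametric_def n by metis
    \<comment> \<open>The isoparametric condition concerns derivatives along \<open>M\<close>; these
      are computed with the extension \<open>\<kappa>' j\<close>.\<close>
    moreover have "deriv_along A M q (E' i q) (\<kappa> j) = E' i q (\<kappa>' j)"
      using \<kappa>'_eq[OF j] q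
      by (intro deriv_along_eq[OF E_tangent[OF i q] \<kappa>'_smooth[OF j]] agree_near_iff_inter[OF openU]) auto
    ultimately show "E' i q (\<kappa>' j) = 0" by simp
  next
    have "(\<lambda>j. E' j p) ` {1..n} = (\<lambda>j. E j p) ` {1..n}"
      by (rule image_cong[OF refl E'_eq[OF _ pU]])
    then show "S p = span ((\<lambda>j. E' j p) ` {1..n})"
      by (simp only: span[OF pU])
    fix v assume "v \<in> S p"
    then show "v \<in> tangent_sub A M p" "null_tau A g D M \<xi> N p v = 0" "g p (N' p) v = 0"
      using screen_subset_tangent_sub[OF S p(1)] \<tau> p(1) N N'_eq[OF pU]
      by (simp_all add: null_transversal_def)
  qed (use cc \<kappa>'_smooth pU \<xi>'_eq N'_eq in auto)
  then show thesis
    using E'_eq[OF _ pU] \<kappa>'_eq[OF _ pU] by (rule that)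
qed

text \<open>Any other candidate differs from \<open>v\<close> by an element of both the screen and
  the normal space, which meet only in zero.\<close>

lemma screen_proj_screen:
  assumes S: "screen_distribution A g M S" and q: "q \<in> M" and sub: "subspace (S q)" and v: "v \<in> S q"
  shows "screen_proj A g M S q v = v"
  unfolding screen_proj_def
proof (rule the_equality)
  have 0: "S q \<inter> tangent_perp A g M q = {0}"
    using S q by (simp add: screen_distribution_def)
  then have "0 \<in> S q" "0 \<in> tangent_perp A g M q" by blast+
  then show "v \<in> S q \<and> v - v \<in> radical A g M q"
    using v screen_subset_tangent_sub[OF S q] by (simp add: radical_def)
  fix s assume s: "s \<in> S q \<and> v - s \<in> radical A g M q"
  then have "v - s \<in> S q \<inter> tangent_perp A g M q"
    using subspace_diff[OF sub v] by (simp add: radical_def)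
  then show "s = v" unfolding 0 by simp
qed

theorem theorem4p4:
  fixes A :: "('m::{t2_space, second_countable_topology}, 'a::euclidean_space) atlas"
    and g :: "'m metric"
    and D :: "'m connection"
    and c :: real
    and M :: "'m set"
    and S :: "'m \<Rightarrow> 'm tvec set"
    and \<xi> N :: "'m vfield"
    and n :: nat
    and p :: 'm
  assumes "DIM('a) = n + 2"
    and "smooth_atlas A"
    and "lorentzian_metric A g"
    and "levi_civita A g D"
    and "constant_curvature A g D c"
    and "null_hypersurface A g M"
    and "screen_distribution A g M S"
    and "null_section A g M \<xi>"
    and "null_transversal A g M S \<xi> N"
    and "null_screen_isoparametric A g D M S \<xi> N"
    and "\<forall>q\<in>M. \<forall>v\<in>S q. null_tau A g D M \<xi> N q v = 0"
    and "p \<in> M"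
  shows
    "(\<forall>x lam W E \<kappa>.
        x \<in> S p \<and> g p x x = 1 \<and> shape_\<xi> A g D M \<xi> N p x = lam *\<^sub>R x \<and>
        p \<in> W \<and> screen_eigenframe A g D M S \<xi> N W E \<kappa> \<longrightarrow>
        (\<Sum>j | j \<in> {1..n} \<and> \<kappa> j p \<noteq> lam.
           (c + lam * g p (shape_N A g D M \<xi> N p (E j p)) (E j p)
              + \<kappa> j p * g p (shape_N A g D M \<xi> N p x) x) / (lam - \<kappa> j p)) = 0)
     \<and>
     (\<forall>W \<phi> \<psi> (l::nat) (\<mu>::nat \<Rightarrow> real) (m::nat \<Rightarrow> nat).
        p \<in> W \<and> screen_quasi_conformal A g D M S \<xi> N W \<phi> \<psi> \<and> (\<exists>q\<in>W. \<psi> q \<noteq> 0) \<and>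
        1 < l \<and> inj_on \<mu> {1..l} \<and>
        \<mu> ` {1..l} = screen_principal_curvatures A g D M S \<xi> N p \<and>
        (\<forall>i\<in>{1..l}. m i = dim (screen_eigenspace A g D M S \<xi> N p (\<mu> i))) \<longrightarrow>
        (\<forall>i\<in>{1..l}.
           (\<Sum>j\<in>{1..l} - {i}.
              real (m j) * ((c + 2 * \<phi> p * \<mu> i * \<mu> j + \<psi> p * (\<mu> i + \<mu> j))
                             / (\<mu> i - \<mu> j))) = 0))"
proof (intro conjI allI impI ballI)
  note ext = eigenframe_extension[OF assms(1,3,4,5,7,8,9,10,11,12)]
  fix x lam W E \<kappa>
  assume x: "x \<in> S p \<and> g p x x = 1 \<and> shape_\<xi> A g D M \<xi> N p x = lam *\<^sub>R x \<and>
        p \<in> W \<and> screen_eigenframe A g D M S \<xi> N W E \<kappa>"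
  then have "p \<in> W" "screen_eigenframe A g D M S \<xi> N W E \<kappa>" by auto
  then obtain U E' \<xi>' N' \<kappa>' where
    ee: "extended_eigenframe A g D n M U E' \<xi>' N' c \<kappa>' p S \<xi> N"
    and eq: "\<And>j. j \<in> {1..n} \<Longrightarrow> E' j p = E j p" "\<And>j. j \<in> {1..n} \<Longrightarrow> \<kappa>' j p = \<kappa> j p"
    by (rule ext) auto
  interpret extended_eigenframe A g D n M U E' \<xi>' N' c \<kappa>' p S \<xi> N by (rule ee)
  have 0: "(\<Sum>j | j \<in> {1..n} \<and> \<kappa>' j p \<noteq> lam.
      (c + lam * g p (shape_N A g D M \<xi> N p (E' j p)) (E' j p)
        + \<kappa>' j p * g p (shape_N A g D M \<xi> N p x) x) / (lam - \<kappa>' j p)) = 0"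
    using x by (intro cartan_identity) auto
  have 1: "(\<Sum>j | j \<in> {1..n} \<and> \<kappa>' j p \<noteq> lam.
      (c + lam * g p (shape_N A g D M \<xi> N p (E' j p)) (E' j p)
        + \<kappa>' j p * g p (shape_N A g D M \<xi> N p x) x) / (lam - \<kappa>' j p)) =
    (\<Sum>j | j \<in> {1..n} \<and> \<kappa> j p \<noteq> lam.
      (c + lam * g p (shape_N A g D M \<xi> N p (E j p)) (E j p)
        + \<kappa> j p * g p (shape_N A g D M \<xi> N p x) x) / (lam - \<kappa> j p))"
    by (rule sum.cong) (auto simp: eq)
  show "(\<Sum>j | j \<in> {1..n} \<and> \<kappa> j p \<noteq> lam.
      (c + lam * g p (shape_N A g D M \<xi> N p (E j p)) (E j p)
        + \<kappa> j p * g p (shape_N A g D M \<xi> N p x) x) / (lam - \<kappa> j p)) = 0"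
    by (rule trans[OF sym[OF 1] 0])
next
  note ext = eigenframe_extension[OF assms(1,3,4,5,7,8,9,10,11,12)]
  fix W \<phi> \<psi> and l :: nat and \<mu> :: "nat \<Rightarrow> real" and m :: "nat \<Rightarrow> nat" and i
  assume *: "p \<in> W \<and> screen_quasi_conformal A g D M S \<xi> N W \<phi> \<psi> \<and> (\<exists>q\<in>W. \<psi> q \<noteq> 0) \<and>
        1 < l \<and> inj_on \<mu> {1..l} \<and>
        \<mu> ` {1..l} = screen_principal_curvatures A g D M S \<xi> N p \<and>
        (\<forall>i\<in>{1..l}. m i = dim (screen_eigenspace A g D M S \<xi> N p (\<mu> i)))"
    and i: "i \<in> {1..l}"
  \<comment> \<open>No frame is given in the quasi-conformal part; one around \<open>p\<close> comes
    from the isoparametric hypothesis.\<close>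
  obtain W' E \<kappa> where W': "p \<in> W'" "screen_eigenframe A g D M S \<xi> N W' E \<kappa>"
    using assms(10,12) unfolding null_screen_isoparametric_def by meson
  then obtain U E' \<xi>' N' \<kappa>' where
    ee: "extended_eigenframe A g D n M U E' \<xi>' N' c \<kappa>' p S \<xi> N"
    by (rule ext) auto
  interpret extended_eigenframe A g D n M U E' \<xi>' N' c \<kappa>' p S \<xi> N by (rule ee)
  show "(\<Sum>j\<in>{1..l} - {i}. real (m j) *
      ((c + 2 * \<phi> p * \<mu> i * \<mu> j + \<psi> p * (\<mu> i + \<mu> j)) / (\<mu> i - \<mu> j))) = 0"
  proof (rule cartan_identity_quasi_conformal)
    fix v assume v: "v \<in> S p"
    \<comment> \<open>On screen vectors the projection is the identity, so the quasi-conformal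
      relation takes the form expected by \<open>cartan_identity_quasi_conformal\<close>.\<close>
    have "screen_proj A g M S p v = v"
      using screen_proj_screen[OF assms(7,12) _ v] by (simp add: S_span)
    then show "shape_N A g D M \<xi> N p v = \<phi> p *\<^sub>R shape_\<xi> A g D M \<xi> N p v + \<psi> p *\<^sub>R v"
      using * S_tangent[OF v] by (simp add: screen_quasi_conformal_def)
  qed (use * i in auto)
qed

end
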